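(* Let $Z\to X\to B$ be a fiber bundle with 10-dimensional fiber $Z$, with vertical tangent bundle $TZ$ equipped with a metric $g^{TZ}$ and an associated Levi-Civita connection $\nabla^{TZ}$. Let $F$ be a Euclidean vector bundle over $X$ with Euclidean connection $\nabla^{F}$, and let $\xi$ be a rank two real oriented Euclidean vector bundle over $X$ with Euclidean connection $\nabla^\xi$ and Euler form $c=e(\xi,\nabla^\xi)$. If $\dim F=32$, then the following identity of differential forms on $X$ holds: $$\begin{aligned} &\{\widehat{A}(TZ)e^{\frac{c}{2}}\mathrm{ch}(\wedge^2{F}_{\mathbf C})\}^{(12)}+\{\widehat{A}(TZ)e^{\frac{c}{2}}\mathrm{ch}(T_{\mathbf C} Z)\}^{(12)}-2\{\widehat{A}(TZ)e^{\frac{c}{2}}\}^{(12)}\\ &+5\{\widehat{A}(TZ)e^{\frac{c}{2}}\mathrm{ch}(\widetilde{\xi_{\mathbf C}}\otimes\widetilde{\xi_{\mathbf C}})\}^{(12)}+3\{\widehat{A}(TZ)e^{\frac{c}{2}}\mathrm{ch}((1-{F}_{\mathbf C})\otimes\widetilde{\xi_{\mathbf C}})\}^{(12)}\\ =\;&(p_1(TZ)-p_1(F))\cdot\left\{-\frac{e^{\frac{1}{24}(p_1(TZ)-p_1(F))}-1}{p_1(TZ)-p_1(F)}\widehat{A}(TZ)e^{\frac{c}{2}}\mathrm{ch}(\mathfrak{G})+e^{\frac{1}{24}(p_1(TZ)-p_1(F))}\widehat{A}(TZ)e^{\frac{c}{2}}\right\}^{(8)}, \end{aligned}$$ where $$\mathfrak{G}=\wedge^2{F}_{\mathbf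 C}+T_{\mathbf C} Z-2+5\widetilde{\xi_{\mathbf C}}\otimes\widetilde{\xi_{\mathbf C}}+3(1-{F}_{\mathbf C})\otimes\widetilde{\xi_{\mathbf C}}.$$ If $\xi$ is trivial, one obtains the Green-Schwarz formula $$\begin{aligned} &\{\widehat{A}(TZ)\mathrm{ch}(\wedge^2{F}_{\mathbf C})\}^{(12)}+\{\widehat{A}(TZ)\mathrm{ch}(T_{\mathbf C} Z)\}^{(12)}-2\{\widehat{A}(TZ)\}^{(12)}\\ =\;&(p_1(TZ)-p_1(F))\left\{-\frac{e^{\frac{1}{24}(p_1(TZ)-p_1(F))}-1}{p_1(TZ)-p_1(F)}\widehat{A}(TZ)\mathrm{ch}(\wedge^2{F}_{\mathbf C}+T_{\mathbf C} Z-2)+e^{\frac{1}{24}(p_1(TZ)-p_1(F))}\widehat{A}(TZ)\right\}^{(8)}. \end{aligned}$$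
   Context: For a differential form $\omega$, $\omega^{(j)}$ (or $\{\omega\}^{(j)}$) is its degree-$j$ component. For a real bundle $E$, $E_{\mathbf C}$ is its complexification with the induced Hermitian connection; $T_{\mathbf C}Z$ is the complexification of $TZ$. For a real (resp. complex) bundle $E$, $\widetilde{E}=E-\dim E$ in $KO(X)$ (resp. $K(X)$). Integers in $K(X)$ denote (virtual) trivial bundles with trivial connection; tensor products and exterior powers $\wedge^2$ carry the induced connections, and $\mathrm{ch}$ is extended additively to virtual bundles. $\widehat{A}(TZ)=\widehat{A}(TZ,\nabla^{TZ})$, $\mathrm{ch}(\cdot)$ and $p_i(\cdot)$ denote the Chern-Weil forms (Hirzebruch $\widehat{A}$-form, Chern character form, Pontryagin forms) of the given connections, connections being suppressed from notation. They are normalized so that, if the formal Chern roots of the complexification of a real bundle are $\pm y_j$ (plus possibly $0$), then $p_1=\sum_j y_j^2$, $\widehat{A}=\prod_j \frac{y_j/2}{\sinh(y_j/2)}$, $\mathrm{ch}$ is the sum of the exponentials of the roots, and the roots of $\xi_{\mathbf C}$ are $\pm c$. The quotient $\frac{e^{x/24}-1}{x}$ is understood as the power series $\sum_{k\ge 1}\frac{x^{k-1}}{24^k k!}$. *)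

theory Defs
  imports
    "HOL-Analysis.Analysis"
    "HOL-Library.Nat_Bijection"
    "HOL-Computational_Algebra.Formal_Power_Series"
begin

section \<open>The exterior algebra on the coordinate covectors\<close>

text \<open>
  An element of \<open>\<Lambda>(R\<^sup>n)*\<close>, with coefficients in a ring, is given by its coefficients with respect
  to the basis \<open>dx_I = dx_i1 \<and> ... \<and> dx_ik\<close> indexed by \<open>I = {i1 < ... < ik}\<close>.
  Multiplication in the type is the wedge product.
\<close>

datatype ('a, 'n) form = Form (coeff: "'n set \<Rightarrow> 'a")

lemma form_eqI: "(\<And>I. coeff a I = coeff b I) \<Longrightarrow> a = b"
  by (cases a; cases b) auto

definition wedge_sign :: "'n::linorder set \<Rightarrow> 'n set \<Rightarrow> 'a::comm_ring_1" where
  "wedge_sign I J = (-1) ^ card {(i, j). i \<in> I \<and> j \<in> J \<and> j < i}"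

instantiation form :: (comm_ring_1, "{finite, linorder}") ring_1
begin

definition zero_form where "0 = Form (\<lambda>I. 0)"
definition one_form where "1 = Form (\<lambda>I. if I = {} then 1 else 0)"
definition plus_form where "a + b = Form (\<lambda>I. coeff a I + coeff b I)"
definition minus_form where "a - b = Form (\<lambda>I. coeff a I - coeff b I)"
definition uminus_form where "- a = Form (\<lambda>I. - coeff a I)"
definition times_form where
  "a * b = Form (\<lambda>K. \<Sum>I\<in>Pow K. wedge_sign I (K - I) * coeff a I * coeff b (K - I))"

lemma wedge_sign_empty [simp]: "wedge_sign {} J = 1" "wedge_sign I {} = 1"
  by (auto simp: wedge_sign_def)

lemma wedge_sign_Un1:
  fixes I J L :: "'n::{finite, linorder} set"
  assumes "I \<inter> J = {}"
  shows "wedge_sign (I \<union> J) L = wedge_sign I L * wedge_sign J L"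
proof -
  have "{(i, j). i \<in> I \<union> J \<and> j \<in> L \<and> j < i} =
      {(i, j). i \<in> I \<and> j \<in> L \<and> j < i} \<union> {(i, j). i \<in> J \<and> j \<in> L \<and> j < i}" by auto
  moreover have "card \<dots> = card {(i, j). i \<in> I \<and> j \<in> L \<and> j < i} + card {(i, j). i \<in> J \<and> j \<in> L \<and> j < i}"
    by (rule card_Un_disjoint) (use assms in auto)
  ultimately show ?thesis by (simp add: wedge_sign_def power_add)
qed

lemma wedge_sign_Un2:
  fixes I J L :: "'n::{finite, linorder} set"
  assumes "J \<inter> L = {}"
  shows "wedge_sign I (J \<union> L) = wedge_sign I J * wedge_sign I L"
proof -
  have "{(i, j). i \<in> I \<and> j \<in> J \<union> L \<and> j < i} =
      {(i, j). i \<in> I \<and> j \<in> J \<and> j < i} \<union> {(i, j). i \<in> I \<and> j \<in> L \<and> j < i}" by auto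
  moreover have "card \<dots> = card {(i, j). i \<in> I \<and> j \<in> J \<and> j < i} + card {(i, j). i \<in> I \<and> j \<in> L \<and> j < i}"
    by (rule card_Un_disjoint) (use assms in auto)
  ultimately show ?thesis by (simp add: wedge_sign_def power_add)
qed

lemma form_mult_assoc:
  fixes a b c :: "('a::comm_ring_1, 'b::{finite, linorder}) form"
  shows "a * b * c = a * (b * c)"
proof (rule form_eqI)
  fix K :: "'b set"
  let ?s = "wedge_sign :: 'b set \<Rightarrow> 'b set \<Rightarrow> 'a"
  let ?L = "Sigma (Pow K) (\<lambda>M. Pow M)" and ?R = "Sigma (Pow K) (\<lambda>I. Pow (K - I))"
  have "coeff (a * b * c) K =
      (\<Sum>M\<in>Pow K. \<Sum>I\<in>Pow M. ?s M (K - M) * ?s I (M - I) * coeff a I * coeff b (M - I) * coeff c (K - M))"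
    by (simp add: times_form_def sum_distrib_left sum_distrib_right mult_ac)
  also have "\<dots> = (\<Sum>(M, I)\<in>?L. ?s M (K - M) * ?s I (M - I) * coeff a I * coeff b (M - I) * coeff c (K - M))"
    by (rule sum.Sigma) auto
  also have "\<dots> = (\<Sum>(I, J)\<in>?R. ?s I (K - I) * ?s J (K - I - J) * coeff a I * coeff b J * coeff c (K - I - J))"
  proof (rule sum.reindex_bij_witness[where i = "\<lambda>(I, J). (I \<union> J, I)" and j = "\<lambda>(M, I). (I, M - I)"], goal_cases)
    case (5 p)
    obtain M I where p: "p = (M, I)" by force
    with 5 have IM: "I \<subseteq> M" "M \<subseteq> K" by auto
    have 1: "?s M (K - M) = ?s I (K - M) * ?s (M - I) (K - M)"
      using wedge_sign_Un1[of I "M - I" "K - M"] IM by (simp add: Un_absorb1)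
    have e: "K - I = (M - I) \<union> (K - M)" and d: "(M - I) \<inter> (K - M) = {}" using IM by auto
    have 2: "?s I (K - I) = ?s I (M - I) * ?s I (K - M)"
      unfolding e by (rule wedge_sign_Un2[OF d])
    have 3: "K - I - (M - I) = K - M" using IM by auto
    show ?case unfolding p by (simp add: 1 2 3 mult_ac)
  qed auto
  also have "\<dots> = (\<Sum>I\<in>Pow K. \<Sum>J\<in>Pow (K - I). ?s I (K - I) * ?s J (K - I - J) * coeff a I * coeff b J * coeff c (K - I - J))"
    by (rule sum.Sigma[symmetric]) auto
  also have "\<dots> = coeff (a * (b * c)) K"
    by (simp add: times_form_def sum_distrib_left mult_ac)
  finally show "coeff (a * b * c) K = coeff (a * (b * c)) K" .
qed

instance
proof
  fix a b c :: "('a, 'b) form"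
  show "a * b * c = a * (b * c)" by (rule form_mult_assoc)
  show "1 * a = a"
  proof (rule form_eqI)
    fix K
    have "coeff (1 * a) K = (\<Sum>I\<in>Pow K. if I = {} then coeff a K else 0)"
      unfolding times_form_def one_form_def form.sel
      by (intro sum.cong) (auto simp del: Diff_eq_empty_iff)
    then show "coeff (1 * a) K = coeff a K" by simp
  qed
  show "a * 1 = a"
  proof (rule form_eqI)
    fix K
    have "coeff (a * 1) K = (\<Sum>I\<in>Pow K. if I = K then coeff a K else 0)"
      unfolding times_form_def one_form_def form.sel
      by (intro sum.cong) auto
    then show "coeff (a * 1) K = coeff a K" by simp
  qed
  show "(a + b) * c = a * c + b * c" "a * (b + c) = a * b + a * c"
    by (simp_all add: times_form_def plus_form_def algebra_simps sum.distrib)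
  show "(0 :: ('a, 'b) form) \<noteq> 1"
    by (auto simp: zero_form_def one_form_def fun_eq_iff)
qed (auto intro!: form_eqI simp: plus_form_def zero_form_def uminus_form_def minus_form_def)

end

text \<open>The same type as \<open>real ^ 'n\<close>.\<close>

type_synonym 'n coords = "(real, 'n) vec"

definition scl :: "'a::comm_ring_1 \<Rightarrow> ('a, 'n::{finite, linorder}) form \<Rightarrow> ('a, 'n) form" where
  "scl r \<omega> = Form (\<lambda>I. r * coeff \<omega> I)"

definition dx :: "'n::{finite, linorder} \<Rightarrow> ('a::comm_ring_1, 'n) form" where
  "dx k = Form (\<lambda>I. if I = {k} then 1 else 0)"

definition homogeneous :: "nat \<Rightarrow> ('a::comm_ring_1, 'n::{finite, linorder}) form \<Rightarrow> bool" where
  "homogeneous p \<omega> \<longleftrightarrow> (\<forall>I. card I \<noteq> p \<longrightarrow> coeff \<omega> I = 0)"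

definition component :: "nat \<Rightarrow> ('a::comm_ring_1, 'n::{finite, linorder}) form \<Rightarrow> ('a, 'n) form" where
  "component p \<omega> = Form (\<lambda>I. if card I = p then coeff \<omega> I else 0)"

definition eval1 :: "(real, 'n::{finite, linorder}) form \<Rightarrow> 'n coords \<Rightarrow> real" where
  "eval1 \<omega> v = (\<Sum>k\<in>UNIV. coeff \<omega> {k} * v $ k)"

definition cplx_form :: "(real, 'n::{finite, linorder}) form \<Rightarrow> (complex, 'n) form" where
  "cplx_form \<omega> = Form (\<lambda>I. complex_of_real (coeff \<omega> I))"

text \<open>
  Value of a power series at a form without component of degree 0: such a form is nilpotent, its
  powers with exponent greater than the dimension vanish, and the sum below is the full series.
\<close>

definition fps_form :: "complex fps \<Rightarrow> (complex, 'n::{finite, linorder}) form \<Rightarrow> (complex, 'n) form" where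
  "fps_form f \<omega> = (\<Sum>k\<le>CARD('n). scl (fps_nth f k) (\<omega> ^ k))"

definition exp_form :: "(complex, 'n::{finite, linorder}) form \<Rightarrow> (complex, 'n) form" where
  "exp_form = fps_form (fps_exp 1)"


section \<open>Smooth manifolds and fibre bundles\<close>

primrec Ck_on :: "nat \<Rightarrow> 'a::real_normed_vector set \<Rightarrow> ('a \<Rightarrow> 'b::real_normed_vector) \<Rightarrow> bool" where
  "Ck_on 0 S f = continuous_on S f"
| "Ck_on (Suc k) S f =
    ((\<forall>y\<in>S. f differentiable (at y)) \<and> (\<forall>v. Ck_on k S (\<lambda>y. frechet_derivative f (at y) v)))"

definition smooth_on :: "'a::real_normed_vector set \<Rightarrow> ('a \<Rightarrow> 'b::real_normed_vector) \<Rightarrow> bool" where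
  "smooth_on S f \<longleftrightarrow> open S \<and> (\<forall>k. Ck_on k S f)"

type_synonym ('x, 'e) chart = "'x set \<times> ('x \<Rightarrow> 'e)"

abbreviation chart_dom :: "('x, 'e) chart \<Rightarrow> 'x set" where "chart_dom c \<equiv> fst c"
abbreviation chart_map :: "('x, 'e) chart \<Rightarrow> 'x \<Rightarrow> 'e" where "chart_map c \<equiv> snd c"
abbreviation chart_inv :: "('x, 'e) chart \<Rightarrow> 'e \<Rightarrow> 'x" where
  "chart_inv c \<equiv> inv_into (chart_dom c) (chart_map c)"

definition smooth_in ::
    "('x, 'e::real_normed_vector) chart \<Rightarrow> 'x set \<Rightarrow> ('x \<Rightarrow> 'b::real_normed_vector) \<Rightarrow> bool" where
  "smooth_in c S f \<longleftrightarrow> smooth_on (chart_map c ` S) (f \<circ> chart_inv c)"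

definition dir_deriv ::
    "('x, 'e::real_normed_vector) chart \<Rightarrow> ('x \<Rightarrow> 'b::real_normed_vector) \<Rightarrow> 'x \<Rightarrow> 'e \<Rightarrow> 'b" where
  "dir_deriv c f x v = frechet_derivative (f \<circ> chart_inv c) (at (chart_map c x)) v"

text \<open>A tangent vector at \<open>x\<close> is represented, for each chart \<open>c\<close> around \<open>x\<close>, by its coordinate vector;
  \<open>dir_deriv c (chart_map d) x v\<close> is the coordinate vector in \<open>d\<close> of the vector with coordinates
  \<open>v\<close> in \<open>c\<close>.\<close>

definition smooth_atlas ::
    "('x::topological_space, 'e::real_normed_vector) chart set \<Rightarrow> bool" where
  "smooth_atlas A \<longleftrightarrow>
    (\<Union>c\<in>A. chart_dom c) = UNIV \<and>
    (\<forall>c\<in>A. open (chart_dom c) \<and> open (chart_map c ` chart_dom c) \<and>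
      homeomorphism (chart_dom c) (chart_map c ` chart_dom c) (chart_map c) (chart_inv c)) \<and>
    (\<forall>c\<in>A. \<forall>d\<in>A. smooth_in c (chart_dom c \<inter> chart_dom d) (chart_map d))"

definition smooth_map_on ::
    "('x::topological_space, 'e::real_normed_vector) chart set \<Rightarrow>
     ('y::topological_space, 'f::real_normed_vector) chart set \<Rightarrow> 'x set \<Rightarrow> ('x \<Rightarrow> 'y) \<Rightarrow> bool" where
  "smooth_map_on A A' S f \<longleftrightarrow> open S \<and> continuous_on S f \<and>
    (\<forall>c\<in>A. \<forall>d\<in>A'. smooth_in c (chart_dom c \<inter> S \<inter> f -` chart_dom d) (chart_map d \<circ> f))"

definition product_atlas :: "('b, 'm) chart set \<Rightarrow> ('z, 'k) chart set \<Rightarrow> ('b \<times> 'z, 'm \<times> 'k) chart set" where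
  "product_atlas AB AZ =
    {(chart_dom b \<times> chart_dom z, map_prod (chart_map b) (chart_map z)) | b z. b \<in> AB \<and> z \<in> AZ}"

text \<open>The local trivializations of a smooth fibre bundle are diffeomorphisms
  \<open>\<Phi> : \<pi> -` V \<rightarrow> V \<times> Z\<close> over \<open>V\<close>, with inverse \<open>\<Psi>\<close>.\<close>

definition fibre_bundle ::
    "('x::topological_space, 'e::real_normed_vector) chart set \<Rightarrow>
     ('b::topological_space, 'm::real_normed_vector) chart set \<Rightarrow>
     ('z::topological_space, 'k::real_normed_vector) chart set \<Rightarrow> ('x \<Rightarrow> 'b) \<Rightarrow> bool" where
  "fibre_bundle AX AB AZ \<pi> \<longleftrightarrow>
    smooth_atlas AX \<and> smooth_atlas AB \<and> smooth_atlas AZ \<and> smooth_map_on AX AB UNIV \<pi> \<and>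
    (\<forall>p. \<exists>V \<Phi> \<Psi>. open V \<and> p \<in> V \<and>
      smooth_map_on AX (product_atlas AB AZ) (\<pi> -` V) \<Phi> \<and>
      smooth_map_on (product_atlas AB AZ) AX (V \<times> UNIV) \<Psi> \<and>
      (\<forall>x\<in>\<pi> -` V. fst (\<Phi> x) = \<pi> x \<and> \<Psi> (\<Phi> x) = x) \<and>
      (\<forall>q\<in>V \<times> UNIV. \<pi> (\<Psi> q) = fst q \<and> \<Phi> (\<Psi> q) = q))"


section \<open>Vector bundles with connection\<close>

text \<open>
  A vector bundle is given by frames \<open>e^c\<close> over the members \<open>c\<close> of an atlas:
  \<open>idx\<close> is the finite set that labels the frame vectors, \<open>trans\<close> are the transition functions,
  \<open>e^d_j = (\<Sum>i. e^c_i * trans c d x i j)\<close>, and \<open>conn\<close> the connection matrices of 1-forms,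
  \<open>\<nabla> e^c_j = (\<Sum>i. e^c_i * conn c x i j)\<close>; the 1-forms are written in the coordinates of \<open>c\<close>.
\<close>

record ('x, 'n, 'a) vec_bundle =
  idx :: "nat set"
  trans :: "('x, 'n coords) chart \<Rightarrow> ('x, 'n coords) chart \<Rightarrow> 'x \<Rightarrow> nat \<Rightarrow> nat \<Rightarrow> 'a"
  conn :: "('x, 'n coords) chart \<Rightarrow> 'x \<Rightarrow> nat \<Rightarrow> nat \<Rightarrow> ('a, 'n) form"

definition delta :: "nat \<Rightarrow> nat \<Rightarrow> 'a::zero_neq_one" where
  "delta i j = (if i = j then 1 else 0)"

text \<open>Euclidean bundles of rank \<open>n\<close> with Euclidean connection, in orthonormal frames: the
  transition functions take values in \<open>O(n)\<close> and the connection forms in \<open>so(n)\<close>.\<close>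

definition euclidean_bundle ::
    "('x::topological_space, 'n::{finite, linorder} coords) chart set \<Rightarrow> nat \<Rightarrow>
     ('x, 'n, real) vec_bundle \<Rightarrow> bool" where
  "euclidean_bundle AX n E \<longleftrightarrow> idx E = {..<n} \<and>
    (\<forall>c\<in>AX. \<forall>d\<in>AX. \<forall>i<n. \<forall>j<n.
      smooth_in c (chart_dom c \<inter> chart_dom d) (\<lambda>x. trans E c d x i j) \<and>
      (\<forall>x\<in>chart_dom c \<inter> chart_dom d.
        (\<Sum>k<n. trans E c d x k i * trans E c d x k j) = delta i j)) \<and>
    (\<forall>c\<in>AX. \<forall>d\<in>AX. \<forall>e\<in>AX. \<forall>x\<in>chart_dom c \<inter> chart_dom d \<inter> chart_dom e. \<forall>i<n. \<forall>j<n.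
      trans E c e x i j = (\<Sum>k<n. trans E c d x i k * trans E d e x k j)) \<and>
    (\<forall>c\<in>AX. \<forall>i<n. \<forall>j<n.
      (\<forall>I. smooth_in c (chart_dom c) (\<lambda>x. coeff (conn E c x i j) I)) \<and>
      (\<forall>x\<in>chart_dom c. homogeneous 1 (conn E c x i j) \<and> conn E c x i j = - conn E c x j i)) \<and>
    (\<forall>c\<in>AX. \<forall>d\<in>AX. \<forall>x\<in>chart_dom c \<inter> chart_dom d. \<forall>i<n. \<forall>j<n. \<forall>v.
      (\<Sum>k<n. trans E c d x i k * eval1 (conn E d x k j) (dir_deriv c (chart_map d) x v)) =
      (\<Sum>k<n. eval1 (conn E c x i k) v * trans E c d x k j) +
        dir_deriv c (\<lambda>z. trans E c d z i j) x v)"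

definition oriented_plane_bundle ::
    "('x::topological_space, 'n::{finite, linorder} coords) chart set \<Rightarrow> ('x, 'n, real) vec_bundle \<Rightarrow> bool" where
  "oriented_plane_bundle AX E \<longleftrightarrow> euclidean_bundle AX 2 E \<and>
    (\<forall>c\<in>AX. \<forall>d\<in>AX. \<forall>x\<in>chart_dom c \<inter> chart_dom d.
      trans E c d x 0 0 * trans E c d x 1 1 - trans E c d x 0 1 * trans E c d x 1 0 > 0)"

text \<open>Triviality of the underlying real bundle of rank \<open>n\<close>: over each chart there is an invertible
  matrix \<open>h c\<close> whose columns express one global frame in the given local frame.\<close>

definition trivial_bundle ::
    "('x::topological_space, 'n::{finite, linorder} coords) chart set \<Rightarrow> nat \<Rightarrow>
     ('x, 'n, real) vec_bundle \<Rightarrow> bool" where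
  "trivial_bundle AX n E \<longleftrightarrow> (\<exists>h h'.
    (\<forall>c\<in>AX. \<forall>i<n. \<forall>j<n. smooth_in c (chart_dom c) (\<lambda>x. h c x i j) \<and>
      (\<forall>x\<in>chart_dom c. (\<Sum>k<n. h c x i k * h' c x k j) = delta i j)) \<and>
    (\<forall>c\<in>AX. \<forall>d\<in>AX. \<forall>x\<in>chart_dom c \<inter> chart_dom d. \<forall>i<n. \<forall>j<n.
      h c x i j = (\<Sum>k<n. trans E c d x i k * (h d x k j :: real))))"


section \<open>The vertical tangent bundle and its Levi-Civita connection\<close>

definition vertical ::
    "('b, 'm::real_normed_vector) chart set \<Rightarrow> ('x \<Rightarrow> 'b) \<Rightarrow>
     ('x, 'e::real_normed_vector) chart \<Rightarrow> 'x \<Rightarrow> 'e \<Rightarrow> bool" where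
  "vertical AB \<pi> c x v \<longleftrightarrow> (\<forall>b\<in>AB. \<pi> x \<in> chart_dom b \<longrightarrow> dir_deriv c (chart_map b \<circ> \<pi>) x v = 0)"

definition vertical_metric ::
    "('x::topological_space, 'n::finite coords) chart set \<Rightarrow> ('b, 'm::real_normed_vector) chart set \<Rightarrow>
     ('x \<Rightarrow> 'b) \<Rightarrow> (('x, 'n coords) chart \<Rightarrow> 'x \<Rightarrow> 'n coords \<Rightarrow> 'n coords \<Rightarrow> real) \<Rightarrow> bool" where
  "vertical_metric AX AB \<pi> g \<longleftrightarrow>
    (\<forall>c\<in>AX. \<forall>x\<in>chart_dom c. \<forall>u v w. \<forall>r.
      vertical AB \<pi> c x u \<longrightarrow> vertical AB \<pi> c x v \<longrightarrow> vertical AB \<pi> c x w \<longrightarrow>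
        g c x u v = g c x v u \<and>
        g c x (r *\<^sub>R u + v) w = r * g c x u w + g c x v w \<and>
        (u \<noteq> 0 \<longrightarrow> g c x u u > 0) \<and>
        (\<forall>d\<in>AX. x \<in> chart_dom d \<longrightarrow>
          g d x (dir_deriv c (chart_map d) x u) (dir_deriv c (chart_map d) x v) = g c x u v)) \<and>
    (\<forall>c\<in>AX. \<forall>S V W. open S \<longrightarrow> S \<subseteq> chart_dom c \<longrightarrow> smooth_in c S V \<longrightarrow> smooth_in c S W \<longrightarrow>
      (\<forall>x\<in>S. vertical AB \<pi> c x (V x) \<and> vertical AB \<pi> c x (W x)) \<longrightarrow>
      smooth_in c S (\<lambda>x. g c x (V x) (W x)))"

text \<open>\<open>T\<close> is the vertical tangent bundle \<open>ker d\<pi>\<close>, of rank \<open>n\<close>, presented in the smooth local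
  frames \<open>e\<close>, orthonormal for \<open>g\<close>, and with a Euclidean connection.\<close>

definition vertical_tangent_bundle ::
    "('x::topological_space, 'n::{finite, linorder} coords) chart set \<Rightarrow>
     ('b, 'm::real_normed_vector) chart set \<Rightarrow> ('x \<Rightarrow> 'b) \<Rightarrow>
     (('x, 'n coords) chart \<Rightarrow> 'x \<Rightarrow> 'n coords \<Rightarrow> 'n coords \<Rightarrow> real) \<Rightarrow> nat \<Rightarrow>
     (('x, 'n coords) chart \<Rightarrow> 'x \<Rightarrow> nat \<Rightarrow> 'n coords) \<Rightarrow> ('x, 'n, real) vec_bundle \<Rightarrow> bool" where
  "vertical_tangent_bundle AX AB \<pi> g n e T \<longleftrightarrow> euclidean_bundle AX n T \<and>
    (\<forall>c\<in>AX.
      (\<forall>i<n. smooth_in c (chart_dom c) (\<lambda>x. e c x i)) \<and>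
      (\<forall>x\<in>chart_dom c.
        {v. vertical AB \<pi> c x v} = span (e c x ` {..<n}) \<and>
        (\<forall>i<n. \<forall>j<n. g c x (e c x i) (e c x j) = delta i j))) \<and>
    (\<forall>c\<in>AX. \<forall>d\<in>AX. \<forall>x\<in>chart_dom c \<inter> chart_dom d. \<forall>j<n.
      dir_deriv d (chart_map c) x (e d x j) = (\<Sum>i<n. trans T c d x i j *\<^sub>R e c x i))"

text \<open>The connection restricts to the Levi-Civita connection of \<open>g\<close> along each fibre. Compatibility
  with \<open>g\<close> being part of the Euclidean structure, this is the vanishing of the torsion on vertical
  vectors, \<open>\<nabla>_(e_i) e_j - \<nabla>_(e_j) e_i = [e_i, e_j]\<close>.\<close>

definition levi_civita ::
    "('x::topological_space, 'n::{finite, linorder} coords) chart set \<Rightarrow> nat \<Rightarrow>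
     (('x, 'n coords) chart \<Rightarrow> 'x \<Rightarrow> nat \<Rightarrow> 'n coords) \<Rightarrow> ('x, 'n, real) vec_bundle \<Rightarrow> bool" where
  "levi_civita AX n e T \<longleftrightarrow>
    (\<forall>c\<in>AX. \<forall>x\<in>chart_dom c. \<forall>i<n. \<forall>j<n.
      (\<Sum>k<n. eval1 (conn T c x k j) (e c x i) *\<^sub>R e c x k) -
      (\<Sum>k<n. eval1 (conn T c x k i) (e c x j) *\<^sub>R e c x k) =
      dir_deriv c (\<lambda>z. e c z j) x (e c x i) - dir_deriv c (\<lambda>z. e c z i) x (e c x j))"


section \<open>Operations on bundles, and virtual bundles\<close>

definition complexify ::
    "('x, 'n::{finite, linorder}, real) vec_bundle \<Rightarrow> ('x, 'n, complex) vec_bundle" where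
  "complexify E = \<lparr> idx = idx E,
     trans = (\<lambda>c d x i j. complex_of_real (trans E c d x i j)),
     conn = (\<lambda>c x i j. cplx_form (conn E c x i j)) \<rparr>"

definition triv :: "nat \<Rightarrow> ('x, 'n::{finite, linorder}, complex) vec_bundle" where
  "triv n = \<lparr> idx = {..<n}, trans = (\<lambda>c d x. delta), conn = (\<lambda>c x i j. 0) \<rparr>"

definition tensor ::
    "('x, 'n::{finite, linorder}, complex) vec_bundle \<Rightarrow> ('x, 'n, complex) vec_bundle \<Rightarrow>
     ('x, 'n, complex) vec_bundle" where
  "tensor E F = \<lparr> idx = prod_encode ` (idx E \<times> idx F),
     trans = (\<lambda>c d x p q. case (prod_decode p, prod_decode q) of ((i, i'), (j, j')) \<Rightarrow>
       trans E c d x i j * trans F c d x i' j'),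
     conn = (\<lambda>c x p q. case (prod_decode p, prod_decode q) of ((i, i'), (j, j')) \<Rightarrow>
       conn E c x i j * delta i' j' + delta i j * conn F c x i' j') \<rparr>"

text \<open>The frame of the second exterior power consists of the \<open>e_j \<and> e_j'\<close> with \<open>j < j'\<close>, and
  \<open>\<nabla> (e_j \<and> e_j') = \<nabla> e_j \<and> e_j' + e_j \<and> \<nabla> e_j'\<close>.\<close>

definition ext2 ::
    "('x, 'n::{finite, linorder}, complex) vec_bundle \<Rightarrow> ('x, 'n, complex) vec_bundle" where
  "ext2 E = \<lparr> idx = prod_encode ` {(i, i'). i \<in> idx E \<and> i' \<in> idx E \<and> i < i'},
     trans = (\<lambda>c d x p q. case (prod_decode p, prod_decode q) of ((i, i'), (j, j')) \<Rightarrow>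
       trans E c d x i j * trans E c d x i' j' - trans E c d x i j' * trans E c d x i' j),
     conn = (\<lambda>c x p q. case (prod_decode p, prod_decode q) of ((i, i'), (j, j')) \<Rightarrow>
       (conn E c x i j * delta i' j' - conn E c x i' j * delta i j') +
       (delta i j * conn E c x i' j' - delta i' j * conn E c x i j')) \<rparr>"

text \<open>Virtual bundles with connection are formal integer combinations of bundles.\<close>

type_synonym ('x, 'n) virtual = "(int \<times> ('x, 'n, complex) vec_bundle) list"

definition vb :: "('x, 'n, complex) vec_bundle \<Rightarrow> ('x, 'n) virtual" where
  "vb E = [(1, E)]"

definition vint :: "int \<Rightarrow> ('x, 'n::{finite, linorder}) virtual" where
  "vint m = [(m, triv 1)]"

definition vscale :: "int \<Rightarrow> ('x, 'n) virtual \<Rightarrow> ('x, 'n) virtual" where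
  "vscale m V = map (\<lambda>(a, E). (m * a, E)) V"

definition vplus :: "('x, 'n) virtual \<Rightarrow> ('x, 'n) virtual \<Rightarrow> ('x, 'n) virtual" (infixl "\<oplus>\<^sub>v" 65) where
  "V \<oplus>\<^sub>v W = V @ W"

definition vminus :: "('x, 'n) virtual \<Rightarrow> ('x, 'n) virtual \<Rightarrow> ('x, 'n) virtual" (infixl "\<ominus>\<^sub>v" 65) where
  "V \<ominus>\<^sub>v W = V @ vscale (- 1) W"

definition vtensor ::
    "('x, 'n::{finite, linorder}) virtual \<Rightarrow> ('x, 'n) virtual \<Rightarrow> ('x, 'n) virtual" (infixl "\<otimes>\<^sub>v" 70) where
  "V \<otimes>\<^sub>v W = [(a * b, tensor E F). (a, E) \<leftarrow> V, (b, F) \<leftarrow> W]"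

definition vreduced :: "('x, 'n::{finite, linorder}, complex) vec_bundle \<Rightarrow> ('x, 'n) virtual" where
  "vreduced E = vb E \<ominus>\<^sub>v vint (int (card (idx E)))"


section \<open>Chern-Weil forms\<close>

text \<open>The forms below are functions of a chart \<open>c\<close> and a point \<open>x\<close>: the value is the form at \<open>x\<close>,
  in the coordinates of \<open>c\<close>.\<close>

definition ext_d ::
    "('x, 'n coords) chart \<Rightarrow> ('x \<Rightarrow> ('a::real_normed_field, 'n::{finite, linorder}) form) \<Rightarrow>
     'x \<Rightarrow> ('a, 'n) form" where
  "ext_d c \<omega> x = (\<Sum>k\<in>UNIV. dx k * Form (\<lambda>I. dir_deriv c (\<lambda>z. coeff (\<omega> z) I) x (axis k 1)))"

definition curvature ::
    "('x, 'n::{finite, linorder}, 'a::real_normed_field) vec_bundle \<Rightarrow> ('x, 'n coords) chart \<Rightarrow> 'x \<Rightarrow>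
     nat \<Rightarrow> nat \<Rightarrow> ('a, 'n) form" where
  "curvature E c x i j =
    ext_d c (\<lambda>z. conn E c z i j) x + (\<Sum>k\<in>idx E. conn E c x i k * conn E c x k j)"

primrec mat_power ::
    "nat set \<Rightarrow> (nat \<Rightarrow> nat \<Rightarrow> 'r::ring_1) \<Rightarrow> nat \<Rightarrow> nat \<Rightarrow> nat \<Rightarrow> 'r" where
  "mat_power S W 0 = delta"
| "mat_power S W (Suc m) = (\<lambda>i j. \<Sum>k\<in>S. W i k * mat_power S W m k j)"

text \<open>\<open>tr f(W)\<close> for \<open>W = (i/2\<pi>) \<Omega>\<close>, whose eigenvalues are the formal Chern roots. Since the entries
  of \<open>\<Omega>\<close> have degree 2, the omitted terms of the series vanish.\<close>

definition trace_fps ::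
    "complex fps \<Rightarrow> ('x, 'n::{finite, linorder}, complex) vec_bundle \<Rightarrow> ('x, 'n coords) chart \<Rightarrow> 'x \<Rightarrow>
     (complex, 'n) form" where
  "trace_fps f E c x =
    (let W = (\<lambda>i j. scl (\<i> / (2 * of_real pi)) (curvature E c x i j)) in
      \<Sum>m\<le>CARD('n). scl (fps_nth f m) (\<Sum>i\<in>idx E. mat_power (idx E) W m i i))"

definition ch ::
    "('x, 'n::{finite, linorder}) virtual \<Rightarrow> ('x, 'n coords) chart \<Rightarrow> 'x \<Rightarrow> (complex, 'n) form" where
  "ch V c x = (\<Sum>(a, E)\<leftarrow>V. of_int a * trace_fps (fps_exp 1) E c x)"

text \<open>
  The multiplicative form \<open>det\<^sup>1\<^sup>/\<^sup>2 f(W) = exp (1/2 tr log f(W))\<close> of a real bundle, for an even power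
  series \<open>f\<close> with constant term 1; in terms of the roots \<open>\<plusminus>y_j\<close> it is the product of the \<open>f(y_j)\<close>.
  Recall that \<open>fps_ln 1\<close> is the series of \<open>ln (1 + X)\<close>.
\<close>

definition genus ::
    "complex fps \<Rightarrow> ('x, 'n::{finite, linorder}, real) vec_bundle \<Rightarrow> ('x, 'n coords) chart \<Rightarrow> 'x \<Rightarrow>
     (complex, 'n) form" where
  "genus f E c x = exp_form (scl (1 / 2) (trace_fps (fps_ln 1 oo (f - 1)) (complexify E) c x))"

text \<open>\<open>(X/2) / sinh (X/2)\<close>\<close>

definition Ahat_fps :: "complex fps" where
  "Ahat_fps = (fps_const (1 / 2) * fps_X) /
    (fps_const (1 / 2) * (fps_exp (1 / 2) - fps_exp (- (1 / 2))))"

definition Ahat ::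
    "('x, 'n::{finite, linorder}, real) vec_bundle \<Rightarrow> ('x, 'n coords) chart \<Rightarrow> 'x \<Rightarrow> (complex, 'n) form" where
  "Ahat = genus Ahat_fps"

definition p1 ::
    "('x, 'n::{finite, linorder}, real) vec_bundle \<Rightarrow> ('x, 'n coords) chart \<Rightarrow> 'x \<Rightarrow> (complex, 'n) form" where
  "p1 E c x = component 4 (genus (1 + fps_X ^ 2) E c x)"

text \<open>Euler form of an oriented plane bundle, the Pfaffian of \<open>\<Omega>/2\<pi>\<close>.\<close>

definition euler_form ::
    "('x, 'n::{finite, linorder}, real) vec_bundle \<Rightarrow> ('x, 'n coords) chart \<Rightarrow> 'x \<Rightarrow> (complex, 'n) form" where
  "euler_form E c x = cplx_form (scl (1 / (2 * pi)) (curvature E c x 0 1))"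

text \<open>The series \<open>(exp (X/24) - 1) / X\<close>.\<close>

definition exp_quotient_fps :: "complex fps" where
  "exp_quotient_fps = Abs_fps (\<lambda>k. 1 / (24 ^ (k + 1) * fact (k + 1)))"

end

theory Submission
  imports Defs
begin

text \<open>
  All forms involved are pointwise polynomials in the power sums \<open>t_k\<close>, \<open>p_k\<close> of the Chern roots of
  \<open>T\<^sub>C Z\<close> and \<open>F\<^sub>C\<close> (traces of powers of the curvature matrix, zero for odd \<open>k\<close> by skew symmetry)
  and in \<open>c\<close>. Since \<open>P = p\<^sub>1(TZ) - p\<^sub>1(F)\<close> has degree 4 and \<open>P \<cdot> (e^(P/24) - 1) / P = e^(P/24) - 1\<close>,
  the formula is equivalent to the vanishing of the degree 12 component of
  \<open>e^(P/24) A(TZ) e^(c/2) (ch(G) - P)\<close>. Expanding the series up to degree 12 turns this into a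
  polynomial identity; the terms in \<open>t\<^sub>6\<close> and \<open>p\<^sub>6\<close> cancel because \<open>rank F = 32\<close> and \<open>rank G = 504\<close>.
  It holds for every \<open>c\<close>, and \<open>c = 0\<close> gives the Green-Schwarz formula.
\<close>

section \<open>Even forms\<close>

text \<open>Connection matrices have entries of odd degree, so the curvatures of tensor products and
  exterior squares are computed in the noncommutative ring of all forms, where the mixed terms
  cancel by anticommutation. Curvature entries have degree 2; from there on everything happens in a
  commutative ring. No splitting into roots is used: the power sums of tensor products and exterior
  squares follow from the binomial formula for Kronecker sums.

  The constants fit as follows. The degree 4 part of A(TZ) is - p_1(TZ)/24, so e^(P/24) A(TZ) starts
  with 1 - p_1(F)/24. The degree 12 part of A(TZ) contains - t_6/362880, and 504/362880 = 1/720 is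
  the coefficient of t_6 in ch(TZ). In the exterior square of a bundle of rank n the coefficient of
  p_6 is a multiple of n - 32. The multiplicities 5 and 3 solve the two linear equations given by
  the coefficients of c^6 and of c^4 p_2.\<close>

lemma wedge_sign_swap:
  fixes I J :: "'n::{finite, linorder} set"
  assumes "I \<inter> J = {}"
  shows "wedge_sign J I = (-1) ^ (card I * card J) * (wedge_sign I J :: 'a::comm_ring_1)"
proof -
  let ?A = "{(i, j). i \<in> I \<and> j \<in> J \<and> j < i}" and ?B = "{(j, i). j \<in> J \<and> i \<in> I \<and> i < j}"
  have B: "prod.swap ` ?B = {(i, j). i \<in> I \<and> j \<in> J \<and> i < j}" by force
  \<comment> \<open>By disjointness each pair (i, j) has either j < i or i < j. These are the
    inversions of the two orders of multiplication, so the two exponents add up to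
    \<open>card I * card J\<close>.\<close>
  have "I \<times> J = ?A \<union> prod.swap ` ?B" unfolding B using assms by (auto simp: neq_iff)
  moreover have "?A \<inter> prod.swap ` ?B = {}" unfolding B by auto
  ultimately have "card I * card J = card ?A + card (prod.swap ` ?B)"
    using card_Un_disjoint[of ?A "prod.swap ` ?B"] by (simp flip: card_cartesian_product)
  moreover have "card (prod.swap ` ?B) = card ?B" by (rule card_image) auto
  ultimately show ?thesis
    by (simp add: wedge_sign_def power_add minus_one_power_iff)
qed

lemma coeff_form_simps [simp]:
  "coeff (0 :: ('a::comm_ring_1, 'n::{finite, linorder}) form) I = 0"
  "coeff (a + b :: ('a, 'n) form) I = coeff a I + coeff b I"
  "coeff (a - b :: ('a, 'n) form) I = coeff a I - coeff b I"
  "coeff (- a :: ('a, 'n) form) I = - coeff a I"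
  "coeff (scl r a :: ('a, 'n) form) I = r * coeff a I"
  "coeff (component k a :: ('a, 'n) form) I = (if card I = k then coeff a I else 0)"
  by (simp_all add: zero_form_def plus_form_def minus_form_def uminus_form_def scl_def
      component_def)

lemma coeff_one: "coeff (1 :: ('a::comm_ring_1, 'n::{finite, linorder}) form) I = (if I = {} then 1 else 0)"
  by (simp add: one_form_def)

lemma coeff_sum [simp]:
  "coeff (sum f S :: ('a::comm_ring_1, 'n::{finite, linorder}) form) I = (\<Sum>s\<in>S. coeff (f s) I)"
  by (induction S rule: infinite_finite_induct) auto

lemma coeff_times:
  "coeff (a * b :: ('a::comm_ring_1, 'n::{finite, linorder}) form) K =
    (\<Sum>I\<in>Pow K. wedge_sign I (K - I) * coeff a I * coeff b (K - I))"
  by (simp add: times_form_def)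

text \<open>Passing to the complement \<open>K - I\<close> lines the reversed product up term by
  term with \<open>a * b\<close>. Commutation rules then only require a look at the parity of
  \<open>card I * card (K - I)\<close>.\<close>

lemma coeff_times_swap:
  "coeff (b * a :: ('a::comm_ring_1, 'n::{finite, linorder}) form) K =
    (\<Sum>I\<in>Pow K. (-1) ^ (card I * card (K - I)) * (wedge_sign I (K - I) * coeff a I * coeff b (K - I)))"
  unfolding coeff_times
proof (rule sum.reindex_bij_witness[where i = "\<lambda>I. K - I" and j = "\<lambda>I. K - I"])
  fix I assume I: "I \<in> Pow K"
  then show "(-1) ^ (card (K - I) * card (K - (K - I))) *
      (wedge_sign (K - I) (K - (K - I)) * coeff a (K - I) * coeff b (K - (K - I))) =
      wedge_sign I (K - I) * coeff b I * coeff a (K - I)"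
    using wedge_sign_swap[of "K - I" I, where ?'a = 'a]
    by (simp add: double_diff mult_ac Diff_disjoint inf_commute[of "K - I"])
qed (auto simp: double_diff)

text \<open>Connection forms are of this kind; the rule removes the mixed terms from the curvature
  of tensor products and exterior squares.\<close>

lemma one_form_anticommute:
  assumes "homogeneous 1 a" "homogeneous 1 (b :: ('a::comm_ring_1, 'n::{finite, linorder}) form)"
  shows "b * a = - (a * b)"
proof (rule form_eqI)
  fix K
  have "(-1) ^ (card I * card (K - I)) * (wedge_sign I (K - I) * coeff a I * coeff b (K - I)) =
      - (wedge_sign I (K - I) * coeff a I * coeff b (K - I))" for I
    using assms by (cases "card I = 1 \<and> card (K - I) = 1") (auto simp: homogeneous_def)
  then show "coeff (b * a) K = coeff (- (a * b)) K"
    by (simp add: coeff_times_swap[of b a] coeff_times[of a b] sum_negf)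
qed

lemma scl_mult [simp]:
  "scl r a * b = scl r (a * b)" "a * scl r b = scl r (a * b)"
  for a b :: "('a::comm_ring_1, 'n::{finite, linorder}) form"
  by (auto intro!: form_eqI simp: coeff_times sum_distrib_left mult_ac)

lemma homogeneous_times:
  fixes a b :: "('a::comm_ring_1, 'n::{finite, linorder}) form"
  assumes "homogeneous p a" "homogeneous q b"
  shows "homogeneous (p + q) (a * b)"
  unfolding homogeneous_def coeff_times
proof safe
  fix K :: "'n set" assume K: "card K \<noteq> p + q"
  show "(\<Sum>I\<in>Pow K. wedge_sign I (K - I) * coeff a I * coeff b (K - I)) = 0"
  proof (rule sum.neutral, safe)
    fix I assume I: "I \<subseteq> K"
    have "card I + card (K - I) = card K"
      using I by (metis card_Diff_subset card_mono finite le_add_diff_inverse)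
    with K have "card I \<noteq> p \<or> card (K - I) \<noteq> q" by auto
    then show "wedge_sign I (K - I) * coeff a I * coeff b (K - I) = 0"
      using assms by (auto simp: homogeneous_def)
  qed
qed

definition even_form :: "('a::comm_ring_1, 'n::{finite, linorder}) form \<Rightarrow> bool" where
  "even_form a \<longleftrightarrow> (\<forall>I. odd (card I) \<longrightarrow> coeff a I = 0)"

lemma homogeneous_even: "homogeneous p a \<Longrightarrow> even p \<Longrightarrow> even_form a"
  by (auto simp: homogeneous_def even_form_def)

lemma even_form_commute:
  assumes "even_form (a :: ('a::comm_ring_1, 'n::{finite, linorder}) form)"
  shows "b * a = a * b"
proof (rule form_eqI)
  fix K
  have "(-1) ^ (card I * card (K - I)) * (wedge_sign I (K - I) * coeff a I * coeff b (K - I)) =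
      wedge_sign I (K - I) * coeff a I * coeff b (K - I)" for I
    using assms by (cases "even (card I)") (auto simp: even_form_def)
  then show "coeff (b * a) K = coeff (a * b) K"
    by (simp add: coeff_times_swap[of b a] coeff_times[of a b])
qed

lemma even_form_times:
  fixes a b :: "('a::comm_ring_1, 'n::{finite, linorder}) form"
  assumes "even_form a" "even_form b"
  shows "even_form (a * b)"
  unfolding even_form_def coeff_times
proof safe
  fix K :: "'n set" assume K: "odd (card K)"
  show "(\<Sum>I\<in>Pow K. wedge_sign I (K - I) * coeff a I * coeff b (K - I)) = 0"
  proof (rule sum.neutral, safe)
    fix I assume I: "I \<subseteq> K"
    have "card I + card (K - I) = card K"
      using I by (metis card_Diff_subset card_mono finite le_add_diff_inverse)
    with K have "odd (card I) \<or> odd (card (K - I))" by presburger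
    then show "wedge_sign I (K - I) * coeff a I * coeff b (K - I) = 0"
      using assms by (auto simp: even_form_def)
  qed
qed

text \<open>Even forms commute; working in the commutative ring that they form gives access to
  \<open>comm_ring_1\<close> reasoning about traces of matrices of 2-forms.\<close>

typedef 'n eform = "{a :: (complex, 'n::{finite, linorder}) form. even_form a}"
  morphisms to_form of_form
  by (rule exI[of _ 0]) (simp add: even_form_def)

setup_lifting type_definition_eform

instantiation eform :: ("{finite, linorder}") comm_ring_1
begin

lift_definition zero_eform :: "'a eform" is 0 by (simp add: even_form_def)
lift_definition one_eform :: "'a eform" is 1 by (auto simp: even_form_def coeff_one)
lift_definition plus_eform :: "'a eform \<Rightarrow> 'a eform \<Rightarrow> 'a eform" is "(+)"
  by (simp add: even_form_def)
lift_definition minus_eform :: "'a eform \<Rightarrow> 'a eform \<Rightarrow> 'a eform" is "(-)"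
  by (simp add: even_form_def)
lift_definition uminus_eform :: "'a eform \<Rightarrow> 'a eform" is uminus
  by (simp add: even_form_def)
lift_definition times_eform :: "'a eform \<Rightarrow> 'a eform \<Rightarrow> 'a eform" is "(*)"
  by (rule even_form_times)

instance
  by standard (transfer; simp add: algebra_simps even_form_commute)+

end

section \<open>Scalars and grading on the ring of even forms\<close>

lift_definition escl :: "complex \<Rightarrow> 'n::{finite, linorder} eform \<Rightarrow> 'n eform" is scl
  by (simp add: even_form_def)

text \<open>The index is half the degree: curvature entries lie in \<open>part 1\<close>, Pontryagin
  forms p_1 in \<open>part 2\<close>, and the degrees 12 and 8 of the theorem are
  \<open>part 6\<close> and \<open>part 4\<close>.\<close>

lift_definition part :: "nat \<Rightarrow> 'n::{finite, linorder} eform \<Rightarrow> 'n eform" is "\<lambda>k. component (2 * k)"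
  by (simp add: even_form_def)

lemmas to_form_simps = zero_eform.rep_eq one_eform.rep_eq plus_eform.rep_eq minus_eform.rep_eq
  uminus_eform.rep_eq times_eform.rep_eq escl.rep_eq part.rep_eq

lemma to_form_sum: "to_form (sum f S) = (\<Sum>s\<in>S. to_form (f s))"
  by (induction S rule: infinite_finite_induct) (auto simp: to_form_simps)

lemma to_form_power: "to_form (a ^ m) = to_form a ^ m"
  by (induction m) (auto simp: to_form_simps)

lemma to_form_of_int: "to_form (of_int k) = of_int k"
proof -
  have "to_form (of_nat n :: 'a eform) = of_nat n" for n
    by (induction n) (auto simp: to_form_simps)
  then show ?thesis by (cases k rule: int_cases2) (auto simp: to_form_simps)
qed

lemma to_form_of_form: "even_form a \<Longrightarrow> to_form (of_form a) = a"
  by (simp add: of_form_inverse)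

lemma escl_simps:
  "escl r (a + b) = escl r a + escl r b" "escl r (a - b) = escl r a - escl r b"
  "escl (r + s) a = escl r a + escl s a" "escl r (- a) = - escl r a"
  "escl r a * b = escl r (a * b)" "a * escl r b = escl r (a * b)"
  "escl r (escl s a) = escl (r * s) a" "escl 1 a = a" "escl 0 a = 0" "escl r 0 = 0"
  "escl (- r) a = - escl r a"
  by (transfer; auto intro!: form_eqI simp: algebra_simps)+

lemma escl_sum: "escl r (sum f S) = (\<Sum>s\<in>S. escl r (f s))"
  by (induction S rule: infinite_finite_induct) (auto simp: escl_simps)

lemma escl_numeral: "escl (numeral k) a = numeral k * a"
proof -
  have "escl (of_nat n) a = of_nat n * a" for n
    by (induction n) (auto simp: escl_simps algebra_simps)
  from this[of "numeral k"] show ?thesis by simp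
qed

lemma escl_of_nat: "escl (of_nat n) a = of_nat n * a"
  by (induction n) (auto simp: escl_simps algebra_simps)

lemma part_simps:
  "part k 0 = 0" "part k (a + b) = part k a + part k b" "part k (a - b) = part k a - part k b"
  "part k (- a) = - part k a" "part k (escl r a) = escl r (part k a)"
  by (transfer; auto intro!: form_eqI)+

lemma part_sum: "part k (sum f S) = (\<Sum>s\<in>S. part k (f s))"
  by (induction S rule: infinite_finite_induct) (auto simp: part_simps)

lemma part_part: "part k (part l a) = (if k = l then part k a else 0)"
  by (transfer; auto intro!: form_eqI)

lemma part_one: "part k 1 = (if k = 0 then 1 else 0)"
  by (transfer; auto intro!: form_eqI simp: coeff_one)

lemma part_of_int: "part k (of_int z) = (if k = 0 then of_int z else 0)"
proof -
  have *: "part k (of_nat n) = (if k = 0 then of_nat n else 0)" for n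
    by (induction n) (auto simp: part_simps part_one)
  then show ?thesis by (cases z rule: int_cases2) (auto simp: part_simps)
qed

lemma part_numeral: "part k (numeral n) = (if k = 0 then numeral n else 0)"
  using part_of_int[of k "numeral n"] by (simp split: if_splits)

lemma part_eqI: "(\<And>k. part k a = part k b) \<Longrightarrow> a = b"
proof (transfer, rule form_eqI)
  fix a b :: "(complex, 'a) form" and I :: "'a set"
  assume ev: "even_form a" "even_form b" and eq: "\<And>k. component (2 * k) a = component (2 * k) b"
  show "coeff a I = coeff b I"
  proof (cases "even (card I)")
    case True
    then obtain k where "card I = 2 * k" by blast
    then show ?thesis using arg_cong[OF eq[of k], of "\<lambda>\<omega>. coeff \<omega> I"] by simp
  qed (use ev in \<open>auto simp: even_form_def\<close>)
qed

lemma part_eq_0: "CARD('n) < 2 * k \<Longrightarrow> part k (a :: 'n::{finite, linorder} eform) = 0"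
proof (transfer, rule form_eqI)
  fix k and a :: "(complex, 'n) form" and I :: "'n set"
  assume "CARD('n) < 2 * k"
  moreover have "card I \<le> CARD('n)" by (rule card_mono) auto
  ultimately show "coeff (component (2 * k) a) I = coeff 0 I" by auto
qed

text \<open>A coefficient at \<open>K\<close> sums over the splittings of \<open>K\<close> into
  \<open>I\<close> and \<open>K - I\<close>. Odd coefficients vanish, so only sets \<open>I\<close>
  of some even cardinality 2i matter, and each such term is counted by exactly one index i.\<close>

lemma part_mult: "part n (a * b) = (\<Sum>i\<le>n. part i a * part (n - i) b)"
proof (rule to_form_inject[THEN iffD1], rule form_eqI)
  fix K :: "'a set"
  define a' b' where "a' = to_form a" and "b' = to_form b"
  have ev: "even_form a'" "even_form b'"
    using to_form[of a] to_form[of b] by (auto simp: a'_def b'_def)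
  let ?t = "\<lambda>I. wedge_sign I (K - I) * coeff a' I * coeff b' (K - I)"
  have *: "(\<Sum>i\<le>n. if card I = 2 * i \<and> card (K - I) = 2 * (n - i) then ?t I else 0) =
      (if card K = 2 * n then ?t I else 0)" if I: "I \<subseteq> K" for I
  proof -
    have c: "card I + card (K - I) = card K"
      using I by (metis card_Diff_subset card_mono finite le_add_diff_inverse)
    show ?thesis
    proof (cases "even (card I) \<and> card K = 2 * n")
      case True
      then obtain i where i: "card I = 2 * i" by blast
      have "(\<Sum>j\<le>n. if card I = 2 * j \<and> card (K - I) = 2 * (n - j) then ?t I else 0) =
          (\<Sum>j\<le>n. if j = i then ?t I else 0)"
        by (rule sum.cong) (use i c True in auto)
      then show ?thesis using i c True by auto
    next
      case False
      then show ?thesis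
        using c ev by (auto intro!: sum.neutral simp: even_form_def)
    qed
  qed
  have "coeff (\<Sum>i\<le>n. component (2 * i) a' * component (2 * (n - i)) b') K =
      (\<Sum>i\<le>n. \<Sum>I\<in>Pow K. if card I = 2 * i \<and> card (K - I) = 2 * (n - i) then ?t I else 0)"
    by (auto simp: coeff_times intro!: sum.cong)
  also have "\<dots> = (\<Sum>I\<in>Pow K. if card K = 2 * n then ?t I else 0)"
    by (subst sum.swap, rule sum.cong) (use * in auto)
  also have "\<dots> = coeff (component (2 * n) (a' * b')) K"
    by (simp add: coeff_times)
  finally show "coeff (to_form (part n (a * b))) K =
      coeff (to_form (\<Sum>i\<le>n. part i a * part (n - i) b)) K"
    by (simp add: to_form_sum to_form_simps a'_def b'_def)
qed

text \<open>The lowest degree multiplies under powers. The value \<open>d = 1\<close> yields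
  nilpotency, and \<open>d = 2\<close> stops the exponential of a form starting in degree 4 after
  its cube.\<close>

lemma part_power_eq_0:
  assumes "\<And>i. i < d \<Longrightarrow> part i a = 0" "k < d * m"
  shows "part k (a ^ m) = 0"
  using assms(2)
proof (induction m arbitrary: k)
  case (Suc m)
  show ?case unfolding power_Suc part_mult
  proof (rule sum.neutral, safe)
    fix i assume "i \<le> k"
    show "part i a * part (k - i) (a ^ m) = 0"
      by (cases "i < d") (use assms Suc \<open>i \<le> k\<close> in auto)
  qed
qed simp

lemma nilpotent_power:
  assumes "part 0 (a :: 'n::{finite, linorder} eform) = 0" "CARD('n) < m"
  shows "a ^ m = 0"
proof (rule part_eqI)
  fix k show "part k (a ^ m) = part k 0"
    using part_power_eq_0[of 1 a k m] assms(1) part_eq_0[of k "a ^ m"] assms(2)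
    by (cases "k < m") (auto simp: part_simps)
qed


section \<open>Power series of even forms\<close>

definition efps :: "complex fps \<Rightarrow> 'n::{finite, linorder} eform \<Rightarrow> 'n eform" where
  "efps f a = (\<Sum>k\<le>CARD('n). escl (fps_nth f k) (a ^ k))"

lemma to_form_efps: "to_form (efps f a) = fps_form f (to_form a)"
  by (simp add: efps_def fps_form_def to_form_sum to_form_simps to_form_power)

lemma efps_extend:
  assumes "part 0 (a :: 'n::{finite, linorder} eform) = 0" "CARD('n) \<le> M"
  shows "efps f a = (\<Sum>k\<le>M. escl (fps_nth f k) (a ^ k))"
  unfolding efps_def using assms
  by (intro sum.mono_neutral_left) (auto simp: nilpotent_power escl_simps)

text \<open>The part in degree 2k only sees powers up to k, so the series may be cut at any
  \<open>M \<ge> k\<close>, whether the dimension is larger or smaller. This frees the computations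
  from \<open>CARD('n)\<close>.\<close>

lemma part_efps:
  assumes "part 0 (a :: 'n::{finite, linorder} eform) = 0" "k \<le> M"
  shows "part k (efps f a) = (\<Sum>m\<le>M. escl (fps_nth f m) (part k (a ^ m)))"
proof -
  have 0: "part k (a ^ m) = 0" if "k < m" for m
    using part_power_eq_0[of 1 a k m] assms(1) that by simp
  have "part k (efps f a) = (\<Sum>m\<le>max M CARD('n). escl (fps_nth f m) (part k (a ^ m)))"
    by (subst efps_extend[OF assms(1)]) (auto simp: part_sum part_simps)
  also have "\<dots> = (\<Sum>m\<le>M. escl (fps_nth f m) (part k (a ^ m)))"
    using assms by (intro sum.mono_neutral_right) (auto simp: 0 escl_simps)
  finally show ?thesis .
qed

section \<open>Powers and traces of matrices\<close>

lemma mat_power_cong: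
  assumes "\<And>i j. i \<in> S \<Longrightarrow> j \<in> S \<Longrightarrow> W i j = W' i j" "i \<in> S" "j \<in> S"
  shows "mat_power S W m i j = mat_power S W' m i j"
  using assms(2,3) by (induction m arbitrary: i) (simp_all add: assms(1))

lemma sum_delta_left:
  "finite S \<Longrightarrow> i \<in> S \<Longrightarrow> (\<Sum>k\<in>S. delta i k * f k) = (f i :: 'r::ring_1)"
  by (simp add: delta_def if_distrib[of "\<lambda>x. x * _"] cong: if_cong)

lemma sum_delta_right:
  "finite S \<Longrightarrow> j \<in> S \<Longrightarrow> (\<Sum>k\<in>S. f k * delta k j) = (f j :: 'r::ring_1)"
  by (simp add: delta_def if_distrib[of "\<lambda>x. _ * x"] cong: if_cong)

lemma mat_power_add:
  assumes "finite S" "i \<in> S"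
  shows "mat_power S W (m + n) i j = (\<Sum>k\<in>S. mat_power S W m i k * mat_power S W n k j)"
  using assms(2)
proof (induction m arbitrary: i)
  case 0
  then show ?case using assms by (simp add: sum_delta_left)
next
  case (Suc m)
  have "mat_power S W (Suc m + n) i j =
      (\<Sum>l\<in>S. \<Sum>k\<in>S. W i l * mat_power S W m l k * mat_power S W n k j)"
    using Suc by (simp add: sum_distrib_left mult.assoc)
  also have "\<dots> = (\<Sum>k\<in>S. mat_power S W (Suc m) i k * mat_power S W n k j)"
    by (subst sum.swap) (simp add: sum_distrib_right)
  finally show ?case .
qed

lemma mat_power_Suc_right:
  assumes "finite S" "i \<in> S" "j \<in> S"
  shows "mat_power S W (Suc m) i j = (\<Sum>k\<in>S. mat_power S W m i k * W k j)"
  using mat_power_add[OF assms(1,2), of W m 1 j] assms by (simp add: sum_delta_right)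

text \<open>Transposition reverses a matrix product, which is harmless because the entries commute,
  and each of the m skew factors contributes one sign.\<close>

lemma mat_power_transpose:
  fixes W :: "nat \<Rightarrow> nat \<Rightarrow> 'r::comm_ring_1"
  assumes S: "finite S" and W: "\<And>i j. i \<in> S \<Longrightarrow> j \<in> S \<Longrightarrow> W i j = - W j i"
    and "i \<in> S" "j \<in> S"
  shows "mat_power S W m j i = (-1) ^ m * mat_power S W m i j"
  using assms(3,4)
proof (induction m arbitrary: j)
  case (Suc m)
  have "mat_power S W (Suc m) j i = (\<Sum>k\<in>S. - W k j * ((-1) ^ m * mat_power S W m i k))"
    using Suc W[of j] by (auto intro!: sum.cong)
  also have "\<dots> = (-1) ^ Suc m * (\<Sum>k\<in>S. mat_power S W m i k * W k j)"
    unfolding sum_distrib_left by (intro sum.cong) (simp_all add: mult_ac)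
  also have "\<dots> = (-1) ^ Suc m * mat_power S W (Suc m) i j"
    using mat_power_Suc_right[OF S] Suc.prems by metis
  finally show ?case .
qed (simp add: delta_def)

section \<open>Traces of matrix powers; Kronecker sums\<close>

definition mat_trace :: "nat set \<Rightarrow> (nat \<Rightarrow> nat \<Rightarrow> 'r::ring_1) \<Rightarrow> nat \<Rightarrow> 'r" where
  "mat_trace S W m = (\<Sum>i\<in>S. mat_power S W m i i)"

lemma mat_trace_cong:
  assumes "\<And>i j. i \<in> S \<Longrightarrow> j \<in> S \<Longrightarrow> W i j = W' i j"
  shows "mat_trace S W m = mat_trace S W' m"
  unfolding mat_trace_def using mat_power_cong[OF assms] by (intro sum.cong) auto

text \<open>Pascal's rule in the form needed for the induction step of the binomial theorem for two
  commuting operators.\<close>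

lemma binomial_convolution_Suc:
  fixes a b :: "nat \<Rightarrow> 'r::comm_ring_1"
  shows "(\<Sum>l\<le>Suc m. of_nat (Suc m choose l) * a l * b (Suc m - l)) =
    (\<Sum>l\<le>m. of_nat (m choose l) * a (Suc l) * b (m - l)) +
    (\<Sum>l\<le>m. of_nat (m choose l) * a l * b (Suc (m - l)))"
proof -
  have "(\<Sum>l\<le>m. of_nat (m choose l) * a l * b (Suc (m - l))) =
      (\<Sum>l\<le>m. of_nat (m choose l) * a l * b (Suc m - l))"
    by (intro sum.cong) (auto simp: Suc_diff_le)
  also have "\<dots> = (\<Sum>l\<le>Suc m. of_nat (m choose l) * a l * b (Suc m - l))"
    by (simp add: binomial_eq_0)
  also have "\<dots> = a 0 * b (Suc m) + (\<Sum>l\<le>m. of_nat (m choose Suc l) * a (Suc l) * b (m - l))"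
    by (subst sum.atMost_Suc_shift) simp
  finally show ?thesis
    by (subst sum.atMost_Suc_shift) (simp add: algebra_simps sum.distrib)
qed

text \<open>Entry \<open>((i, i'), (j, j'))\<close> of the \<open>m\<close>-th power of \<open>W \<otimes> 1 + 1 \<otimes> V\<close>.\<close>

definition tensor_power ::
    "nat set \<Rightarrow> (nat \<Rightarrow> nat \<Rightarrow> 'r::comm_ring_1) \<Rightarrow> nat set \<Rightarrow> (nat \<Rightarrow> nat \<Rightarrow> 'r) \<Rightarrow> nat \<Rightarrow>
      nat \<Rightarrow> nat \<Rightarrow> nat \<Rightarrow> nat \<Rightarrow> 'r" where
  "tensor_power S W T V m i i' j j' =
    (\<Sum>k\<le>m. of_nat (m choose k) * mat_power S W k i j * mat_power T V (m - k) i' j')"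

text \<open>The Kronecker sum \<open>W \<otimes> 1 + 1 \<otimes> V\<close>, by which connection and
  curvature act on a tensor product. Row (i, i') and column (j, j') stay separate here;
  \<open>unpair\<close> translates to the single natural numbers that label frames.\<close>

definition tensor_sum :: "(nat \<Rightarrow> nat \<Rightarrow> 'r) \<Rightarrow> (nat \<Rightarrow> nat \<Rightarrow> 'r::ring_1) \<Rightarrow>
    nat \<Rightarrow> nat \<Rightarrow> nat \<Rightarrow> nat \<Rightarrow> 'r" where
  "tensor_sum W V i i' j j' = W i j * delta i' j' + delta i j * V i' j'"

definition unpair :: "(nat \<Rightarrow> nat \<Rightarrow> nat \<Rightarrow> nat \<Rightarrow> 'r) \<Rightarrow> nat \<Rightarrow> nat \<Rightarrow> 'r" where
  "unpair M p q = (case (prod_decode p, prod_decode q) of ((i, i'), (j, j')) \<Rightarrow> M i i' j j')"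

definition unpair_alt :: "(nat \<Rightarrow> nat \<Rightarrow> nat \<Rightarrow> nat \<Rightarrow> 'r::ring_1) \<Rightarrow> nat \<Rightarrow> nat \<Rightarrow> 'r" where
  "unpair_alt M = unpair (\<lambda>i i' j j'. M i i' j j' - M i' i j j')"

lemma unpair_encode [simp]:
  "unpair M (prod_encode (i, i')) (prod_encode (j, j')) = M i i' j j'"
  by (simp add: unpair_def)

lemma unpair_alt_encode [simp]:
  "unpair_alt M (prod_encode (i, i')) (prod_encode (j, j')) = M i i' j j' - M i' i j j'"
  by (simp add: unpair_alt_def)

lemma sum_prod_encode:
  "(\<Sum>p\<in>prod_encode ` X. f p) = (\<Sum>(i, j)\<in>X. f (prod_encode (i, j)))"
  by (subst sum.reindex) (auto simp: case_prod_unfold intro: inj_on_subset[OF inj_prod_encode])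

lemma tensor_sum_mult:
  fixes A B :: "nat \<Rightarrow> nat \<Rightarrow> 'r::ring_1"
  assumes "finite S" "finite T" "i \<in> S" "i' \<in> T"
  shows "(\<Sum>k\<in>S. \<Sum>k'\<in>T. tensor_sum A B i i' k k' * M k k') =
    (\<Sum>k\<in>S. A i k * M k i') + (\<Sum>k'\<in>T. B i' k' * M i k')"
proof -
  have "(\<Sum>k\<in>S. \<Sum>k'\<in>T. tensor_sum A B i i' k k' * M k k') =
      (\<Sum>k\<in>S. A i k * (\<Sum>k'\<in>T. delta i' k' * M k k')) +
      (\<Sum>k\<in>S. delta i k * (\<Sum>k'\<in>T. B i' k' * M k k'))"
    by (simp add: tensor_sum_def algebra_simps sum.distrib sum_distrib_left)
  then show ?thesis using assms by (simp add: sum_delta_left)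
qed

text \<open>\<open>W \<otimes> 1\<close> and \<open>1 \<otimes> V\<close> commute, so powers of
  their sum obey the binomial theorem, with Pascal's rule as the induction step.\<close>

lemma tensor_power_Suc:
  fixes W V :: "nat \<Rightarrow> nat \<Rightarrow> 'r::comm_ring_1"
  assumes "finite S" "finite T" "i \<in> S" "i' \<in> T"
  shows "(\<Sum>k\<in>S. \<Sum>k'\<in>T. tensor_sum W V i i' k k' * tensor_power S W T V m k k' j j') =
    tensor_power S W T V (Suc m) i i' j j'"
proof -
  have 1: "(\<Sum>k\<in>S. W i k * tensor_power S W T V m k i' j j') =
      (\<Sum>l\<le>m. of_nat (m choose l) * mat_power S W (Suc l) i j * mat_power T V (m - l) i' j')"
    unfolding tensor_power_def sum_distrib_left
    by (subst sum.swap) (simp add: sum_distrib_left sum_distrib_right mult_ac)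
  have 2: "(\<Sum>k'\<in>T. V i' k' * tensor_power S W T V m i k' j j') =
      (\<Sum>l\<le>m. of_nat (m choose l) * mat_power S W l i j * mat_power T V (Suc (m - l)) i' j')"
    unfolding tensor_power_def sum_distrib_left
    by (subst sum.swap) (simp add: sum_distrib_left sum_distrib_right mult_ac)
  show ?thesis
    unfolding tensor_sum_mult[OF assms] 1 2
    unfolding tensor_power_def by (rule binomial_convolution_Suc[symmetric])
qed

lemma tensor_power_0: "tensor_power S W T V 0 i i' j j' = delta i j * delta i' j'"
  by (simp add: tensor_power_def)

lemma mat_power_tensor:
  fixes W V :: "nat \<Rightarrow> nat \<Rightarrow> 'r::comm_ring_1"
  assumes S: "finite S" and T: "finite T" and "i \<in> S" "i' \<in> T"
  shows "mat_power (prod_encode ` (S \<times> T)) (unpair (tensor_sum W V)) m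
      (prod_encode (i, i')) (prod_encode (j, j')) = tensor_power S W T V m i i' j j'"
  using assms(3,4)
proof (induction m arbitrary: i i')
  case (Suc m)
  have "mat_power (prod_encode ` (S \<times> T)) (unpair (tensor_sum W V)) (Suc m)
      (prod_encode (i, i')) (prod_encode (j, j')) =
      (\<Sum>k\<in>S. \<Sum>k'\<in>T. tensor_sum W V i i' k k' * tensor_power S W T V m k k' j j')"
    by (auto simp: sum_prod_encode sum.cartesian_product Suc.IH intro!: sum.cong)
  then show ?case using tensor_power_Suc[OF S T Suc.prems] by simp
qed (simp add: tensor_power_0 delta_def)

text \<open>The trace of a Kronecker product is the product of the traces. In terms of roots this
  expands the sum of all (x_i + y_j)^m.\<close>

lemma mat_trace_tensor:
  fixes W V :: "nat \<Rightarrow> nat \<Rightarrow> 'r::comm_ring_1"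
  assumes S: "finite S" and T: "finite T"
  shows "mat_trace (prod_encode ` (S \<times> T)) (unpair (tensor_sum W V)) m =
    (\<Sum>k\<le>m. of_nat (m choose k) * mat_trace S W k * mat_trace T V (m - k))"
proof -
  have "mat_trace (prod_encode ` (S \<times> T)) (unpair (tensor_sum W V)) m =
      (\<Sum>i\<in>S. \<Sum>i'\<in>T. tensor_power S W T V m i i' i i')"
    unfolding mat_trace_def sum_prod_encode sum.cartesian_product
    by (rule sum.cong) (auto simp: mat_power_tensor[OF S T])
  also have "\<dots> = (\<Sum>k\<le>m. \<Sum>i\<in>S. \<Sum>i'\<in>T.
      of_nat (m choose k) * mat_power S W k i i * mat_power T V (m - k) i' i')"
    unfolding tensor_power_def by (simp add: sum.swap[of _ "{..m}"])
  also have "\<dots> = (\<Sum>k\<le>m. of_nat (m choose k) * mat_trace S W k * mat_trace T V (m - k))"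
    unfolding mat_trace_def sum_distrib_left sum_distrib_right by (subst sum.swap) (rule refl)
  finally show ?thesis .
qed

section \<open>Traces on the second exterior power\<close>

lemma sum_square_split:
  fixes f :: "nat \<Rightarrow> nat \<Rightarrow> 'r::ring_1"
  assumes "finite S" "\<And>k. k \<in> S \<Longrightarrow> f k k = 0"
  shows "(\<Sum>k\<in>S. \<Sum>k'\<in>S. f k k') = (\<Sum>(k, k')\<in>{(k, k'). k \<in> S \<and> k' \<in> S \<and> k < k'}. f k k' + f k' k)"
proof -
  let ?L = "{(k, k'). k \<in> S \<and> k' \<in> S \<and> k < k'}" and ?D = "{(k, k'). k \<in> S \<and> k' \<in> S \<and> k = k'}"
    and ?U = "{(k, k'). k \<in> S \<and> k' \<in> S \<and> k' < k}"
  have fin: "finite ?L" "finite ?D" "finite ?U"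
    by (rule finite_subset[of _ "S \<times> S"]; use assms in auto)+
  have "S \<times> S = ?L \<union> (?D \<union> ?U)" by auto
  then have "(\<Sum>(k, k')\<in>S \<times> S. f k k') = (\<Sum>(k, k')\<in>?L \<union> (?D \<union> ?U). f k k')" by simp
  also have "\<dots> = (\<Sum>(k, k')\<in>?L. f k k') + ((\<Sum>(k, k')\<in>?D. f k k') + (\<Sum>(k, k')\<in>?U. f k k'))"
    using fin by (subst sum.union_disjoint; (subst sum.union_disjoint)?) auto
  also have "(\<Sum>(k, k')\<in>?D. f k k') = 0" by (rule sum.neutral) (auto simp: assms)
  also have "(\<Sum>(k, k')\<in>?U. f k k') = (\<Sum>(k, k')\<in>?L. f k' k)"
    by (rule sum.reindex_bij_witness[of _ prod.swap prod.swap]) auto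
  finally show ?thesis
    by (simp add: sum.cartesian_product case_prod_unfold sum.distrib)
qed

text \<open>The antisymmetrization \<open>unpair_alt M\<close> is the matrix on \<open>\<Lambda>\<^sup>2\<close> of an endomorphism \<open>M\<close> of the tensor
  square that commutes with the swap, so it is multiplicative in \<open>M\<close>.\<close>

lemma unpair_alt_mult:
  fixes M N :: "nat \<Rightarrow> nat \<Rightarrow> nat \<Rightarrow> nat \<Rightarrow> 'r::ring_1"
  assumes S: "finite S"
    and M: "\<And>k k'. k \<in> S \<Longrightarrow> k' \<in> S \<Longrightarrow> M i' i k' k = M i i' k k'"
  shows "(\<Sum>q\<in>prod_encode ` {(k, k'). k \<in> S \<and> k' \<in> S \<and> k < k'}.
      unpair_alt M (prod_encode (i, i')) q * unpair_alt N q (prod_encode (j, j'))) =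
    (\<Sum>k\<in>S. \<Sum>k'\<in>S. M i i' k k' * N k k' j j') - (\<Sum>k\<in>S. \<Sum>k'\<in>S. M i' i k k' * N k k' j j')"
    (is "?lhs = ?rhs")
proof -
  let ?f = "\<lambda>k k'. M i i' k k' * (N k k' j j' - N k' k j j')"
  have "?lhs = (\<Sum>(k, k')\<in>{(k, k'). k \<in> S \<and> k' \<in> S \<and> k < k'}. ?f k k' + ?f k' k)"
    unfolding sum_prod_encode
  proof (rule sum.cong[OF refl], clarify)
    fix k k' assume "k \<in> S" "k' \<in> S"
    then show "unpair_alt M (prod_encode (i, i')) (prod_encode (k, k')) *
        unpair_alt N (prod_encode (k, k')) (prod_encode (j, j')) = ?f k k' + ?f k' k"
      using M[of k' k] by (simp add: algebra_simps)
  qed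
  also have "\<dots> = (\<Sum>k\<in>S. \<Sum>k'\<in>S. ?f k k')"
    by (rule sum_square_split[symmetric]) (use S in auto)
  also have "\<dots> = (\<Sum>k\<in>S. \<Sum>k'\<in>S. M i i' k k' * N k k' j j') -
      (\<Sum>k\<in>S. \<Sum>k'\<in>S. M i i' k k' * N k' k j j')"
    by (simp add: algebra_simps sum_subtractf)
  also have "(\<Sum>k\<in>S. \<Sum>k'\<in>S. M i i' k k' * N k' k j j') =
      (\<Sum>k\<in>S. \<Sum>k'\<in>S. M i' i k k' * N k k' j j')"
    by (subst sum.swap) (simp add: M cong: sum.cong)
  finally show ?thesis .
qed

lemma tensor_sum_swap: "tensor_sum W W i' i j' j = tensor_sum W W i i' j j'"
  by (auto simp: tensor_sum_def delta_def)

lemma mat_power_ext2: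
  fixes W :: "nat \<Rightarrow> nat \<Rightarrow> 'r::comm_ring_1"
  assumes S: "finite S" and "i \<in> S" "i' \<in> S" "i < i'" "j \<in> S" "j' \<in> S" "j < j'"
  defines "L \<equiv> prod_encode ` {(k, k'). k \<in> S \<and> k' \<in> S \<and> k < k'}"
  shows "mat_power L (unpair_alt (tensor_sum W W)) m (prod_encode (i, i')) (prod_encode (j, j')) =
    unpair_alt (tensor_power S W S W m) (prod_encode (i, i')) (prod_encode (j, j'))"
  using assms(2-4)
proof (induction m arbitrary: i i')
  case 0
  \<comment> \<open>The row-swapped term is nonzero only if i' = j and i = j', which contradicts i <
    i' and j < j'.\<close>
  then show ?case using assms(6,7) by (auto simp: tensor_power_0 delta_def)
next
  case (Suc m)
  have "mat_power L (unpair_alt (tensor_sum W W)) (Suc m) (prod_encode (i, i')) (prod_encode (j, j')) =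
      (\<Sum>q\<in>L. unpair_alt (tensor_sum W W) (prod_encode (i, i')) q *
        unpair_alt (tensor_power S W S W m) q (prod_encode (j, j')))"
    by (auto simp: L_def Suc.IH[unfolded L_def] simp del: unpair_alt_encode intro!: sum.cong)
  also have "\<dots> = unpair_alt (tensor_power S W S W (Suc m)) (prod_encode (i, i')) (prod_encode (j, j'))"
    unfolding L_def
    by (subst unpair_alt_mult[OF S tensor_sum_swap]) (use S Suc.prems in \<open>simp add: tensor_power_Suc\<close>)
  finally show ?case .
qed

text \<open>In terms of roots, the sum of (x_i + x_j)^m over i < j is half of the sum over all pairs
  minus the diagonal terms (2 x_i)^m. The factor 2 stays on the left because the ring need not allow
  division.\<close>

lemma mat_trace_ext2:
  fixes W :: "nat \<Rightarrow> nat \<Rightarrow> 'r::comm_ring_1"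
  assumes S: "finite S"
  shows "2 * mat_trace (prod_encode ` {(k, k'). k \<in> S \<and> k' \<in> S \<and> k < k'})
      (unpair_alt (tensor_sum W W)) m =
    (\<Sum>k\<le>m. of_nat (m choose k) * mat_trace S W k * mat_trace S W (m - k)) - 2 ^ m * mat_trace S W m"
proof -
  let ?L = "{(k, k'). k \<in> S \<and> k' \<in> S \<and> k < k'}" and ?X = "tensor_power S W S W m"
  have sym: "?X i' i j' j = ?X i i' j j'" for i i' j j'
    unfolding tensor_power_def
    by (rule sum.reindex_bij_witness[where i = "\<lambda>k. m - k" and j = "\<lambda>k. m - k"])
      (auto simp: mult_ac binomial_symmetric[symmetric])
  \<comment> \<open>Exchanging both index pairs at once leaves the entries unchanged by
    \<open>sym\<close>, so doubling the sum over i < i' gives the sum over all of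
    \<open>S \<times> S\<close>.\<close>
  have "2 * mat_trace (prod_encode ` ?L) (unpair_alt (tensor_sum W W)) m =
      (\<Sum>(i, i')\<in>?L. (?X i i' i i' - ?X i' i i i') + (?X i' i i' i - ?X i i' i' i))"
    unfolding mat_trace_def sum_prod_encode sum_distrib_left
    by (rule sum.cong) (auto simp: mat_power_ext2[OF S] sym)
  also have "\<dots> = (\<Sum>i\<in>S. \<Sum>i'\<in>S. ?X i i' i i' - ?X i' i i i')"
    by (rule sum_square_split[symmetric]) (use S in auto)
  also have "\<dots> = (\<Sum>i\<in>S. \<Sum>i'\<in>S. ?X i i' i i') - (\<Sum>i\<in>S. \<Sum>i'\<in>S. ?X i' i i i')"
    by (simp add: sum_subtractf)
  also have "(\<Sum>i\<in>S. \<Sum>i'\<in>S. ?X i i' i i') = mat_trace (prod_encode ` (S \<times> S)) (unpair (tensor_sum W W)) m"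
    unfolding mat_trace_def sum_prod_encode sum.cartesian_product
    by (rule sum.cong) (auto simp: mat_power_tensor[OF S S])
  \<comment> \<open>The swap turns a product of two traces into the trace of one product, tr (W^k
    W^(m-k)) = tr W^m, and the binomial coefficients then add up to 2^m.\<close>
  also have "(\<Sum>i\<in>S. \<Sum>i'\<in>S. ?X i' i i i') = (\<Sum>k\<le>m. of_nat (m choose k) *
      (\<Sum>i'\<in>S. \<Sum>i\<in>S. mat_power S W k i' i * mat_power S W (m - k) i i'))"
    unfolding tensor_power_def
    by (subst sum.swap) (simp add: sum.swap[of _ "{..m}"] sum_distrib_left mult.assoc)
  also have "\<dots> = (\<Sum>k\<le>m. of_nat (m choose k) * mat_trace S W m)"
  proof (rule sum.cong[OF refl])
    fix k assume "k \<in> {..m}"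
    then have "(\<Sum>i\<in>S. mat_power S W k i' i * mat_power S W (m - k) i i') = mat_power S W m i' i'"
      if "i' \<in> S" for i'
      using mat_power_add[OF S that, of W k "m - k" i'] by simp
    then show "of_nat (m choose k) * (\<Sum>i'\<in>S. \<Sum>i\<in>S. mat_power S W k i' i * mat_power S W (m - k) i i') =
        of_nat (m choose k) * mat_trace S W m"
      by (simp add: mat_trace_def)
  qed
  also have "\<dots> = 2 ^ m * mat_trace S W m"
    using choose_row_sum[of m] by (metis of_nat_sum of_nat_power of_nat_numeral sum_distrib_right)
  finally show ?thesis by (simp add: mat_trace_tensor[OF S S])
qed

text \<open>Diagonal entries are fixed by transposition yet change sign for odd m. Concluding from 2
  a = 0 to a = 0 uses the complex scalars of \<open>eform\<close>.\<close>

lemma mat_trace_odd: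
  fixes W :: "nat \<Rightarrow> nat \<Rightarrow> 'n::{finite, linorder} eform"
  assumes S: "finite S" and W: "\<And>i j. i \<in> S \<Longrightarrow> j \<in> S \<Longrightarrow> W i j = - W j i" and "odd m"
  shows "mat_trace S W m = 0"
proof -
  have "mat_power S W m i i = 0" if "i \<in> S" for i
  proof -
    have "mat_power S W m i i = - mat_power S W m i i"
      using mat_power_transpose[OF S W that that, where m = m] \<open>odd m\<close> by simp
    then have "2 * mat_power S W m i i = 0" by (simp add: eq_neg_iff_add_eq_0)
    then have "escl (1 / 2) (escl 2 (mat_power S W m i i)) = 0"
      by (simp add: escl_numeral escl_simps(10))
    then show ?thesis by (simp add: escl_simps)
  qed
  then show ?thesis by (simp add: mat_trace_def)
qed

lemma part_mat_power:
  fixes W :: "nat \<Rightarrow> nat \<Rightarrow> 'n::{finite, linorder} eform"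
  assumes W: "\<And>i j k. i \<in> S \<Longrightarrow> j \<in> S \<Longrightarrow> k \<noteq> 1 \<Longrightarrow> part k (W i j) = 0" and "i \<in> S" "j \<in> S" "k \<noteq> m"
  shows "part k (mat_power S W m i j) = 0"
  using assms(2-4)
proof (induction m arbitrary: i k)
  case 0
  then show ?case by (auto simp: delta_def part_one part_simps)
next
  case (Suc m)
  show ?case unfolding mat_power.simps part_sum part_mult
  proof (intro sum.neutral ballI)
    fix l r assume l: "l \<in> S" and r: "r \<in> {..k}"
    show "part r (W i l) * part (k - r) (mat_power S W m l j) = 0"
    proof (cases "r = 1")
      case True
      then have "k - r \<noteq> m" using Suc.prems(3) r by auto
      then show ?thesis using Suc l by simp
    qed (use W Suc.prems l in simp)
  qed
qed

lemma part_mat_trace: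
  fixes W :: "nat \<Rightarrow> nat \<Rightarrow> 'n::{finite, linorder} eform"
  assumes W: "\<And>i j k. i \<in> S \<Longrightarrow> j \<in> S \<Longrightarrow> k \<noteq> 1 \<Longrightarrow> part k (W i j) = 0"
  shows "part k (mat_trace S W m) = (if k = m then mat_trace S W m else 0)"
proof -
  have 0: "part k (mat_trace S W m) = 0" if "k \<noteq> m" for k
    unfolding mat_trace_def part_sum using W that by (intro sum.neutral ballI part_mat_power) auto
  have "part m (mat_trace S W m) = mat_trace S W m"
    by (rule part_eqI) (metis part_part 0)
  with 0 show ?thesis by simp
qed

section \<open>Curvature\<close>

text \<open>What the pointwise calculus takes from the atlas: the image of the chart is open, so
  derivatives at \<open>x\<close> depend only on values inside the chart.\<close>

definition chart_at :: "('x, 'n::finite coords) chart \<Rightarrow> 'x \<Rightarrow> bool" where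
  "chart_at c x \<longleftrightarrow> open (chart_map c ` chart_dom c) \<and> x \<in> chart_dom c"

text \<open>The bundle axioms constrain connection forms only on \<open>chart_dom c\<close>. This
  lets homogeneity and skew symmetry, known there, be differentiated.\<close>

lemma dir_deriv_cong:
  assumes "chart_at c x" "\<And>z. z \<in> chart_dom c \<Longrightarrow> f z = g z"
  shows "dir_deriv c f x = dir_deriv c g x"
proof -
  have eq: "(f \<circ> chart_inv c) y = (g \<circ> chart_inv c) y" if "y \<in> chart_map c ` chart_dom c" for y
    using that assms(2) by (simp add: inv_into_into)
  have x: "open (chart_map c ` chart_dom c)" "chart_map c x \<in> chart_map c ` chart_dom c"
    using assms(1) by (auto simp: chart_at_def)
  have "(f \<circ> chart_inv c has_derivative D) (at (chart_map c x)) \<longleftrightarrow>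
      (g \<circ> chart_inv c has_derivative D) (at (chart_map c x))" for D
    by (rule iffI; erule has_derivative_transform_within_open[OF _ x]; simp only: eq)
  then show ?thesis by (simp add: dir_deriv_def frechet_derivative_def fun_eq_iff)
qed

abbreviation differentiable_in :: "('x, 'n::finite coords) chart \<Rightarrow> 'x \<Rightarrow> ('x \<Rightarrow> 'b::real_normed_vector) \<Rightarrow> bool" where
  "differentiable_in c x f \<equiv> (f \<circ> chart_inv c) differentiable (at (chart_map c x))"

lemma dir_deriv_eqI:
  assumes "(f \<circ> chart_inv c has_derivative D) (at (chart_map c x))"
  shows "dir_deriv c f x v = D v"
  using frechet_derivative_at[OF assms] by (simp add: dir_deriv_def)

lemma has_derivative_dir_deriv:
  assumes "differentiable_in c x f"
  shows "(f \<circ> chart_inv c has_derivative dir_deriv c f x) (at (chart_map c x))"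
  using assms unfolding frechet_derivative_works dir_deriv_def by simp

lemma dir_deriv_0: "dir_deriv c (\<lambda>z. 0) x v = 0"
  by (rule dir_deriv_eqI[where D = "\<lambda>v. 0"]) (simp add: o_def)

lemma dir_deriv_add:
  assumes "differentiable_in c x f" "differentiable_in c x g"
  shows "dir_deriv c (\<lambda>z. f z + g z) x v = dir_deriv c f x v + dir_deriv c g x v"
  using has_derivative_add[OF assms[THEN has_derivative_dir_deriv]]
  by (intro dir_deriv_eqI[where D = "\<lambda>v. dir_deriv c f x v + dir_deriv c g x v"]) (simp add: o_def)

lemma dir_deriv_minus:
  assumes "differentiable_in c x f"
  shows "dir_deriv c (\<lambda>z. - f z) x v = - dir_deriv c f x v"
  using has_derivative_minus[OF assms[THEN has_derivative_dir_deriv]]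
  by (intro dir_deriv_eqI[where D = "\<lambda>v. - dir_deriv c f x v"]) (simp add: o_def)

lemma dir_deriv_of_real:
  assumes "differentiable_in c x f"
  shows "dir_deriv c (\<lambda>z. complex_of_real (f z)) x v = complex_of_real (dir_deriv c f x v)"
  using has_derivative_of_real[OF assms[THEN has_derivative_dir_deriv]]
  by (intro dir_deriv_eqI[where D = "\<lambda>v. complex_of_real (dir_deriv c f x v)"]) (simp add: o_def)

section \<open>The exterior derivative in a chart\<close>

definition differentiable_form ::
    "('x, 'n coords) chart \<Rightarrow> 'x \<Rightarrow> ('x \<Rightarrow> ('a::real_normed_field, 'n::{finite, linorder}) form) \<Rightarrow> bool" where
  "differentiable_form c x \<omega> \<longleftrightarrow> (\<forall>I. differentiable_in c x (\<lambda>z. coeff (\<omega> z) I))"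

lemma differentiable_form_intros:
  "differentiable_form c x (\<lambda>z. 0)"
  "differentiable_form c x \<omega> \<Longrightarrow> differentiable_form c x (\<lambda>z. - \<omega> z)"
  "differentiable_form c x \<omega> \<Longrightarrow> differentiable_form c x \<eta> \<Longrightarrow> differentiable_form c x (\<lambda>z. \<omega> z + \<eta> z)"
  by (simp_all add: differentiable_form_def o_def)

lemma ext_d_cong:
  assumes "chart_at c x" "\<And>z. z \<in> chart_dom c \<Longrightarrow> \<omega> z = \<eta> z"
  shows "ext_d c \<omega> x = ext_d c \<eta> x"
  unfolding ext_d_def using assms
  by (intro sum.cong arg_cong[where f = "(*) _"] form_eqI) (auto intro: fun_cong[OF dir_deriv_cong])

lemma ext_d_0: "ext_d c (\<lambda>z. 0) x = 0"
  unfolding ext_d_def by (rule sum.neutral) (auto intro!: form_eqI simp: coeff_times dir_deriv_0)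

lemma ext_d_add:
  assumes "differentiable_form c x \<omega>" "differentiable_form c x \<eta>"
  shows "ext_d c (\<lambda>z. \<omega> z + \<eta> z) x = ext_d c \<omega> x + ext_d c \<eta> x"
proof -
  have "Form (\<lambda>I. dir_deriv c (\<lambda>z. coeff (\<omega> z + \<eta> z) I) x v) =
      Form (\<lambda>I. dir_deriv c (\<lambda>z. coeff (\<omega> z) I) x v) + Form (\<lambda>I. dir_deriv c (\<lambda>z. coeff (\<eta> z) I) x v)" for v
    by (rule form_eqI) (use assms in \<open>simp add: dir_deriv_add differentiable_form_def\<close>)
  then show ?thesis unfolding ext_d_def by (simp only: distrib_left sum.distrib)
qed

lemma ext_d_minus:
  assumes "differentiable_form c x \<omega>"
  shows "ext_d c (\<lambda>z. - \<omega> z) x = - ext_d c \<omega> x"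
proof -
  have "Form (\<lambda>I. dir_deriv c (\<lambda>z. coeff (- \<omega> z) I) x v) =
      - Form (\<lambda>I. dir_deriv c (\<lambda>z. coeff (\<omega> z) I) x v)" for v
    by (rule form_eqI) (use assms in \<open>simp add: dir_deriv_minus differentiable_form_def\<close>)
  then show ?thesis unfolding ext_d_def by (simp add: sum_negf)
qed

lemma ext_d_diff:
  assumes "differentiable_form c x \<omega>" "differentiable_form c x \<eta>"
  shows "ext_d c (\<lambda>z. \<omega> z - \<eta> z) x = ext_d c \<omega> x - ext_d c \<eta> x"
  using ext_d_add[OF assms(1) differentiable_form_intros(2)[OF assms(2)]] ext_d_minus[OF assms(2)]
  by simp

lemma homogeneous_0: "homogeneous p 0"
  by (simp add: homogeneous_def)

lemma homogeneous_add: "homogeneous p a \<Longrightarrow> homogeneous p b \<Longrightarrow> homogeneous p (a + b)"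
  by (simp add: homogeneous_def)

lemma homogeneous_minus: "homogeneous p a \<Longrightarrow> homogeneous p (- a)"
  by (simp add: homogeneous_def)

lemma homogeneous_sum: "(\<And>s. s \<in> S \<Longrightarrow> homogeneous p (f s)) \<Longrightarrow> homogeneous p (sum f S)"
  by (auto simp: homogeneous_def intro!: sum.neutral)

lemma ext_d_homogeneous:
  fixes \<omega> :: "'x \<Rightarrow> ('a::real_normed_field, 'n::{finite, linorder}) form"
  assumes "chart_at c x" "\<And>z. z \<in> chart_dom c \<Longrightarrow> homogeneous p (\<omega> z)"
  shows "homogeneous (Suc p) (ext_d c \<omega> x)"
  unfolding ext_d_def
proof (rule homogeneous_sum)
  fix k :: 'n
  have 1: "homogeneous 1 (dx k :: ('a, 'n) form)" by (auto simp: homogeneous_def dx_def)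
  have "dir_deriv c (\<lambda>z. coeff (\<omega> z) I) x v = 0" if "card I \<noteq> p" for I v
    using dir_deriv_cong[OF assms(1), of "\<lambda>z. coeff (\<omega> z) I" "\<lambda>z. 0"] assms(2) that
    by (simp add: homogeneous_def dir_deriv_0)
  then have "homogeneous p (Form (\<lambda>I. dir_deriv c (\<lambda>z. coeff (\<omega> z) I) x v))" for v
    by (simp add: homogeneous_def)
  from homogeneous_times[OF 1 this]
  show "homogeneous (Suc p) (dx k * Form (\<lambda>I. dir_deriv c (\<lambda>z. coeff (\<omega> z) I) x (axis k 1)))"
    by simp
qed

lemma cplx_form_simps:
  "cplx_form 0 = 0" "cplx_form (a + b) = cplx_form a + cplx_form b"
  "cplx_form (- a) = - cplx_form a" "cplx_form (scl r a) = scl (of_real r) (cplx_form a)"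
  by (auto intro!: form_eqI simp: cplx_form_def)

lemma cplx_form_times: "cplx_form (a * b) = cplx_form a * cplx_form b"
proof -
  have "complex_of_real (wedge_sign I J) = wedge_sign I J" for I J :: "'a set"
    by (simp add: wedge_sign_def)
  then show ?thesis by (auto intro!: form_eqI simp: cplx_form_def coeff_times)
qed

lemma cplx_form_sum: "cplx_form (sum f S) = (\<Sum>s\<in>S. cplx_form (f s))"
  by (induction S rule: infinite_finite_induct) (auto simp: cplx_form_simps)

lemma ext_d_cplx:
  assumes "differentiable_form c x \<omega>"
  shows "ext_d c (\<lambda>z. cplx_form (\<omega> z)) x = cplx_form (ext_d c \<omega> x)"
proof -
  have 1: "cplx_form (dx k) = dx k" for k :: 'b
    by (auto intro!: form_eqI simp: cplx_form_def dx_def)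
  have "cplx_form (Form (\<lambda>I. dir_deriv c (\<lambda>z. coeff (\<omega> z) I) x v)) =
      Form (\<lambda>I. dir_deriv c (\<lambda>z. coeff (cplx_form (\<omega> z)) I) x v)" for v
    using assms by (simp add: cplx_form_def dir_deriv_of_real differentiable_form_def)
  then show ?thesis unfolding ext_d_def by (simp add: cplx_form_sum cplx_form_times 1)
qed

text \<open>Differentiability is asked at \<open>x\<close> alone, homogeneity on the whole chart,
  since the exterior derivative at \<open>x\<close> sees neighbouring values. The condition passes
  to complexifications, tensor products and exterior squares.\<close>

definition regular_conn ::
    "('x, 'n coords) chart \<Rightarrow> 'x \<Rightarrow> ('x, 'n::{finite, linorder}, 'a::real_normed_field) vec_bundle \<Rightarrow> bool" where
  "regular_conn c x E \<longleftrightarrow> finite (idx E) \<and> (\<forall>i\<in>idx E. \<forall>j\<in>idx E.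
    differentiable_form c x (\<lambda>z. conn E c z i j) \<and> (\<forall>z\<in>chart_dom c. homogeneous 1 (conn E c z i j)))"

definition skew_conn ::
    "('x, 'n coords) chart \<Rightarrow> ('x, 'n::{finite, linorder}, 'a::real_normed_field) vec_bundle \<Rightarrow> bool" where
  "skew_conn c E \<longleftrightarrow> (\<forall>z\<in>chart_dom c. \<forall>i\<in>idx E. \<forall>j\<in>idx E. conn E c z i j = - conn E c z j i)"

lemma skew_connD:
  "skew_conn c E \<Longrightarrow> z \<in> chart_dom c \<Longrightarrow> i \<in> idx E \<Longrightarrow> j \<in> idx E \<Longrightarrow> conn E c z i j = - conn E c z j i"
  unfolding skew_conn_def by blast

lemma homogeneous_curvature:
  assumes c: "chart_at c x" and E: "regular_conn c x E" and ij: "i \<in> idx E" "j \<in> idx E"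
  shows "homogeneous 2 (curvature E c x i j)"
proof -
  have "homogeneous (1 + 1) (conn E c x i k * conn E c x k j)" if "k \<in> idx E" for k
    using assms that by (intro homogeneous_times) (auto simp: regular_conn_def chart_at_def)
  moreover have "homogeneous (Suc 1) (ext_d c (\<lambda>z. conn E c z i j) x)"
    using assms by (intro ext_d_homogeneous) (auto simp: regular_conn_def)
  ultimately show ?thesis
    by (auto simp: curvature_def numeral_2_eq_2 intro!: homogeneous_add homogeneous_sum)
qed

text \<open>In the quadratic term the two signs from skew symmetry cancel; the sign that remains
  comes from anticommuting the two 1-forms.\<close>

lemma curvature_skew:
  assumes c: "chart_at c x" and E: "regular_conn c x E" and skew: "skew_conn c E"
    and ij: "i \<in> idx E" "j \<in> idx E"
  shows "curvature E c x i j = - curvature E c x j i"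
proof -
  have x: "x \<in> chart_dom c" using c by (simp add: chart_at_def)
  have "ext_d c (\<lambda>z. conn E c z i j) x = ext_d c (\<lambda>z. - conn E c z j i) x"
    by (rule ext_d_cong[OF c]) (rule skew_connD[OF skew _ ij])
  also have "\<dots> = - ext_d c (\<lambda>z. conn E c z j i) x"
    by (rule ext_d_minus) (use E ij in \<open>auto simp: regular_conn_def\<close>)
  finally have 1: "ext_d c (\<lambda>z. conn E c z i j) x = - ext_d c (\<lambda>z. conn E c z j i) x" .
  have "conn E c x i k * conn E c x k j = - (conn E c x j k * conn E c x k i)" if k: "k \<in> idx E" for k
  proof -
    have "conn E c x i k * conn E c x k j = conn E c x k i * conn E c x j k"
      using skew_connD[OF skew x ij(1) k] skew_connD[OF skew x k ij(2)] minus_mult_minus by metis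
    also have "\<dots> = - (conn E c x j k * conn E c x k i)"
      using E x ij k by (intro one_form_anticommute) (auto simp: regular_conn_def)
    finally show ?thesis .
  qed
  then show ?thesis by (simp add: curvature_def 1 sum_negf)
qed

lemma idx_complexify [simp]: "idx (complexify E) = idx E"
  by (simp add: complexify_def)

lemma differentiable_complex_of_real:
  "f differentiable F \<Longrightarrow> (\<lambda>y. complex_of_real (f y)) differentiable F"
  unfolding differentiable_def using has_derivative_of_real by blast

lemma complexify_regular:
  assumes "regular_conn c x E"
  shows "regular_conn c x (complexify E)"
  using assms
  by (auto simp: regular_conn_def complexify_def differentiable_form_def cplx_form_def
      homogeneous_def o_def differentiable_complex_of_real)

lemma complexify_skew:
  assumes "skew_conn c E"
  shows "skew_conn c (complexify E)"
  unfolding skew_conn_def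
proof (intro ballI)
  fix z i j assume "z \<in> chart_dom c" "i \<in> idx (complexify E)" "j \<in> idx (complexify E)"
  then have "cplx_form (conn E c z i j) = cplx_form (- conn E c z j i)"
    using skew_connD[OF assms, of z i j] by simp
  then show "conn (complexify E) c z i j = - conn (complexify E) c z j i"
    by (simp add: complexify_def cplx_form_simps)
qed

lemma curvature_complexify:
  assumes "regular_conn c x E" "i \<in> idx E" "j \<in> idx E"
  shows "curvature (complexify E) c x i j = cplx_form (curvature E c x i j)"
  using assms unfolding curvature_def
  by (simp add: complexify_def ext_d_cplx regular_conn_def cplx_form_simps cplx_form_sum cplx_form_times)

section \<open>Curvature of tensor products and exterior squares\<close>

lemma conn_tensor: "conn (tensor E F) c z = unpair (tensor_sum (conn E c z) (conn F c z))"
  by (auto simp: tensor_def unpair_def tensor_sum_def fun_eq_iff split: prod.splits)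

lemma conn_ext2: "conn (ext2 E) c z = unpair_alt (tensor_sum (conn E c z) (conn E c z))"
  by (auto simp: ext2_def unpair_alt_def unpair_def tensor_sum_def fun_eq_iff split: prod.splits)

lemma idx_tensor: "idx (tensor E F) = prod_encode ` (idx E \<times> idx F)"
  by (simp add: tensor_def)

lemma idx_ext2: "idx (ext2 E) = prod_encode ` {(i, i'). i \<in> idx E \<and> i' \<in> idx E \<and> i < i'}"
  by (simp add: ext2_def)

lemma differentiable_tensor_sum:
  assumes "differentiable_form c x (\<lambda>z. A z i j)" "differentiable_form c x (\<lambda>z. B z i' j')"
  shows "differentiable_form c x (\<lambda>z. tensor_sum (A z) (B z) i i' j j')"
  using assms by (auto simp: tensor_sum_def delta_def intro!: differentiable_form_intros)

lemma ext_d_tensor_sum: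
  assumes "differentiable_form c x (\<lambda>z. A z i j)" "differentiable_form c x (\<lambda>z. B z i' j')"
  shows "ext_d c (\<lambda>z. tensor_sum (A z) (B z) i i' j j') x =
    tensor_sum (\<lambda>i j. ext_d c (\<lambda>z. A z i j) x) (\<lambda>i j. ext_d c (\<lambda>z. B z i j) x) i i' j j'"
  using assms by (auto simp: tensor_sum_def delta_def ext_d_add ext_d_0)

lemma homogeneous_tensor_sum:
  assumes "homogeneous p (A i j)" "homogeneous p (B i' j')"
  shows "homogeneous p (tensor_sum A B i i' j j')"
  using assms by (auto simp: tensor_sum_def delta_def homogeneous_add homogeneous_0)

text \<open>The cross terms of \<open>(A \<otimes> 1 + 1 \<otimes> B)\<^sup>2\<close> at a given
  entry are \<open>A i j * B i' j'\<close> and \<open>B i' j' * A i j\<close>, which cancel by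
  \<open>anti\<close>. The ring is noncommutative because the entries are 1-forms.\<close>

lemma tensor_sum_square:
  fixes A B :: "nat \<Rightarrow> nat \<Rightarrow> 'r::ring_1"
  assumes S: "finite S" "finite T" "i \<in> S" "i' \<in> T" "j \<in> S" "j' \<in> T"
    and anti: "B i' j' * A i j = - (A i j * B i' j')"
  shows "(\<Sum>k\<in>S. \<Sum>k'\<in>T. tensor_sum A B i i' k k' * tensor_sum A B k k' j j') =
    tensor_sum (\<lambda>i j. \<Sum>k\<in>S. A i k * A k j) (\<lambda>i j. \<Sum>k\<in>T. B i k * B k j) i i' j j'"
proof -
  have 1: "(\<Sum>k\<in>S. A i k * tensor_sum A B k i' j j') =
      (\<Sum>k\<in>S. A i k * A k j) * delta i' j' + A i j * B i' j'"
  proof -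
    have "(\<Sum>k\<in>S. A i k * (delta k j * B i' j')) = A i j * B i' j'"
      using S by (simp add: delta_def if_distrib[of "\<lambda>x. _ * x"] if_distrib[of "\<lambda>x. x * _"] cong: if_cong)
    then show ?thesis
      by (simp add: tensor_sum_def distrib_left sum.distrib sum_distrib_right mult.assoc)
  qed
  have 2: "(\<Sum>k'\<in>T. B i' k' * tensor_sum A B i k' j j') =
      B i' j' * A i j + delta i j * (\<Sum>k'\<in>T. B i' k' * B k' j')"
  proof -
    have "(\<Sum>k'\<in>T. B i' k' * (A i j * delta k' j')) = B i' j' * A i j"
      using S by (simp add: delta_def if_distrib[of "\<lambda>x. _ * x"] cong: if_cong)
    moreover have "(\<Sum>k'\<in>T. B i' k' * (delta i j * B k' j')) = delta i j * (\<Sum>k'\<in>T. B i' k' * B k' j')"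
      by (simp add: delta_def)
    ultimately show ?thesis by (simp add: tensor_sum_def distrib_left sum.distrib)
  qed
  show ?thesis
    unfolding tensor_sum_mult[OF S(1-4)] 1 2 by (simp add: tensor_sum_def anti)
qed

lemma tensor_sum_add:
  "tensor_sum A B i i' j j' + tensor_sum A' B' i i' j j' =
    tensor_sum (\<lambda>i j. A i j + A' i j) (\<lambda>i j. B i j + B' i j) i i' j j'"
  by (simp add: tensor_sum_def algebra_simps)

lemma tensor_regular:
  assumes "regular_conn c x E" "regular_conn c x F"
  shows "regular_conn c x (tensor E F)"
  using assms unfolding regular_conn_def conn_tensor idx_tensor
  by (auto intro!: differentiable_tensor_sum homogeneous_tensor_sum)

lemma curvature_tensor:
  assumes c: "chart_at c x" and EF: "regular_conn c x E" "regular_conn c x F"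
    and i: "i \<in> idx E" "i' \<in> idx F" and j: "j \<in> idx E" "j' \<in> idx F"
  shows "curvature (tensor E F) c x (prod_encode (i, i')) (prod_encode (j, j')) =
    tensor_sum (curvature E c x) (curvature F c x) i i' j j'"
proof -
  have x: "x \<in> chart_dom c" using c by (simp add: chart_at_def)
  have fin: "finite (idx E)" "finite (idx F)" using EF by (auto simp: regular_conn_def)
  have anti: "conn F c x i' j' * conn E c x i j = - (conn E c x i j * conn F c x i' j')"
    using EF x i j by (intro one_form_anticommute) (auto simp: regular_conn_def)
  show ?thesis
    unfolding curvature_def conn_tensor idx_tensor sum_prod_encode unpair_encode
    using EF i j tensor_sum_square[where A = "conn E c x" and B = "conn F c x", OF fin i j anti]
    by (simp add: ext_d_tensor_sum regular_conn_def tensor_sum_add flip: sum.cartesian_product)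
qed

lemma finite_pairs: "finite S \<Longrightarrow> finite {(i, i'). i \<in> S \<and> i' \<in> S \<and> P i i'}"
  by (rule finite_subset[of _ "S \<times> S"]) auto

lemma ext2_regular:
  assumes "regular_conn c x E"
  shows "regular_conn c x (ext2 E)"
proof -
  have "differentiable_form c x (\<lambda>z. tensor_sum (conn E c z) (conn E c z) i i' j j' -
        tensor_sum (conn E c z) (conn E c z) i' i j j')"
    "z \<in> chart_dom c \<Longrightarrow> homogeneous 1 (tensor_sum (conn E c z) (conn E c z) i i' j j' -
        tensor_sum (conn E c z) (conn E c z) i' i j j')"
    if "i \<in> idx E" "i' \<in> idx E" "j \<in> idx E" "j' \<in> idx E" for i i' j j' z
    using assms that unfolding diff_conv_add_uminus
    by (auto simp: regular_conn_def intro!: differentiable_form_intros differentiable_tensor_sum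
        homogeneous_add homogeneous_minus homogeneous_tensor_sum simp del: add_uminus_conv_diff)
  then show ?thesis
    using assms by (auto simp: regular_conn_def conn_ext2 idx_ext2 finite_pairs)
qed

lemma curvature_ext2:
  assumes c: "chart_at c x" and E: "regular_conn c x E"
    and i: "i \<in> idx E" "i' \<in> idx E" and j: "j \<in> idx E" "j' \<in> idx E"
  shows "curvature (ext2 E) c x (prod_encode (i, i')) (prod_encode (j, j')) =
    unpair_alt (tensor_sum (curvature E c x) (curvature E c x)) (prod_encode (i, i')) (prod_encode (j, j'))"
proof -
  let ?A = "conn E c x"
  have x: "x \<in> chart_dom c" using c by (simp add: chart_at_def)
  have fin: "finite (idx E)" using E by (auto simp: regular_conn_def)
  \<comment> \<open>The first relation serves the direct term of \<open>unpair_alt\<close>, the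
    second its row-swapped term.\<close>
  have anti: "?A i' j' * ?A i j = - (?A i j * ?A i' j')" "?A i j' * ?A i' j = - (?A i' j * ?A i j')"
    using E x i j by (auto intro!: one_form_anticommute simp: regular_conn_def)
  have 1: "(\<Sum>q\<in>idx (ext2 E). conn (ext2 E) c x (prod_encode (i, i')) q *
        conn (ext2 E) c x q (prod_encode (j, j'))) =
      unpair_alt (tensor_sum (\<lambda>i j. \<Sum>k\<in>idx E. ?A i k * ?A k j) (\<lambda>i j. \<Sum>k\<in>idx E. ?A i k * ?A k j))
        (prod_encode (i, i')) (prod_encode (j, j'))"
    unfolding conn_ext2 idx_ext2
    by (subst unpair_alt_mult[OF fin tensor_sum_swap])
      (simp add: tensor_sum_square[where A = ?A and B = ?A, OF fin fin i j anti(1)] 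
        tensor_sum_square[where A = ?A and B = ?A, OF fin fin i(2,1) j anti(2)])
  have d: "differentiable_form c x (\<lambda>z. tensor_sum (conn E c z) (conn E c z) k k' j j')"
    if "k \<in> idx E" "k' \<in> idx E" for k k'
    using E j that by (auto simp: regular_conn_def intro!: differentiable_tensor_sum)
  have 2: "ext_d c (\<lambda>z. conn (ext2 E) c z (prod_encode (i, i')) (prod_encode (j, j'))) x =
      unpair_alt (tensor_sum (\<lambda>i j. ext_d c (\<lambda>z. conn E c z i j) x) (\<lambda>i j. ext_d c (\<lambda>z. conn E c z i j) x))
        (prod_encode (i, i')) (prod_encode (j, j'))"
    using E i j by (simp add: conn_ext2 ext_d_diff d ext_d_tensor_sum regular_conn_def)
  show ?thesis
    unfolding curvature_def[of "ext2 E"] 1 2 unpair_alt_encode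
    by (simp add: curvature_def tensor_sum_def algebra_simps)
qed

lemma triv_regular: "regular_conn c x (triv n)"
  by (auto simp: regular_conn_def triv_def homogeneous_0 differentiable_form_intros)

lemma curvature_triv: "curvature (triv n) c x i j = 0"
  by (simp add: curvature_def triv_def ext_d_0)

lemma smooth_on_differentiable: "smooth_on S f \<Longrightarrow> y \<in> S \<Longrightarrow> f differentiable (at y)"
  by (auto simp: smooth_on_def dest: spec[of _ "Suc 0"])

lemma euclidean_bundle_regular:
  assumes "euclidean_bundle AX n E" "c \<in> AX" "x \<in> chart_dom c"
  shows "regular_conn c x E" "skew_conn c E" "idx E = {..<n}"
proof -
  have idx: "idx E = {..<n}"
    using assms(1) unfolding euclidean_bundle_def by (elim conjE)
  have "\<forall>c\<in>AX. \<forall>i<n. \<forall>j<n. (\<forall>I. smooth_in c (chart_dom c) (\<lambda>x. coeff (conn E c x i j) I)) \<and>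
      (\<forall>x\<in>chart_dom c. homogeneous 1 (conn E c x i j) \<and> conn E c x i j = - conn E c x j i)"
    using assms(1) unfolding euclidean_bundle_def by (elim conjE)
  then have *: "\<forall>i<n. \<forall>j<n. (\<forall>I. smooth_in c (chart_dom c) (\<lambda>x. coeff (conn E c x i j) I)) \<and>
      (\<forall>x\<in>chart_dom c. homogeneous 1 (conn E c x i j) \<and> conn E c x i j = - conn E c x j i)"
    using assms(2) by (elim bspec)
  have "differentiable_form c x (\<lambda>z. conn E c z i j)" if "i < n" "j < n" for i j
    using * that assms(3) smooth_on_differentiable unfolding differentiable_form_def smooth_in_def
    by blast
  moreover have "\<forall>i<n. \<forall>j<n. \<forall>z\<in>chart_dom c. homogeneous 1 (conn E c z i j)" using * by blast
  ultimately show "regular_conn c x E"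
    unfolding regular_conn_def idx by simp
  show "skew_conn c E"
    using * unfolding skew_conn_def idx lessThan_iff by blast
  show "idx E = {..<n}" by (rule idx)
qed

section \<open>The Chern character\<close>

text \<open>Here the curvature enters the commutative ring. \<open>of_form\<close> is meaningful on
  even forms only, which \<open>to_form_chern_matrix\<close> secures from the degree of the
  curvature.\<close>

definition chern_matrix ::
    "('x, 'n::{finite, linorder}, complex) vec_bundle \<Rightarrow> ('x, 'n coords) chart \<Rightarrow> 'x \<Rightarrow>
      nat \<Rightarrow> nat \<Rightarrow> 'n eform" where
  "chern_matrix E c x i j = of_form (scl (\<i> / (2 * of_real pi)) (curvature E c x i j))"

definition power_sum ::
    "('x, 'n::{finite, linorder}, complex) vec_bundle \<Rightarrow> ('x, 'n coords) chart \<Rightarrow> 'x \<Rightarrow> nat \<Rightarrow> 'n eform" where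
  "power_sum E c x m = mat_trace (idx E) (chern_matrix E c x) m"

lemma to_form_chern_matrix:
  assumes "chart_at c x" "regular_conn c x E" "i \<in> idx E" "j \<in> idx E"
  shows "to_form (chern_matrix E c x i j) = scl (\<i> / (2 * of_real pi)) (curvature E c x i j)"
  unfolding chern_matrix_def
  by (rule to_form_of_form, rule homogeneous_even[of 2])
    (use homogeneous_curvature[OF assms] in \<open>simp_all add: homogeneous_def\<close>)

lemma part_chern_matrix:
  assumes "chart_at c x" "regular_conn c x E" "i \<in> idx E" "j \<in> idx E" "k \<noteq> 1"
  shows "part k (chern_matrix E c x i j) = 0"
proof (rule to_form_inject[THEN iffD1], rule form_eqI)
  fix I
  show "coeff (to_form (part k (chern_matrix E c x i j))) I = coeff (to_form 0) I"
    using homogeneous_curvature[OF assms(1-4)] assms(5)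
    by (simp add: to_form_simps to_form_chern_matrix[OF assms(1-4)] homogeneous_def)
qed

lemma part_power_sum:
  assumes "chart_at c x" "regular_conn c x E"
  shows "part k (power_sum E c x m) = (if k = m then power_sum E c x m else 0)"
  unfolding power_sum_def by (rule part_mat_trace) (rule part_chern_matrix[OF assms])

lemma power_sum_0: "power_sum E c x 0 = of_nat (card (idx E))"
  by (simp add: power_sum_def mat_trace_def delta_def)

lemma power_sum_odd:
  assumes "chart_at c x" "regular_conn c x E" "skew_conn c E" "odd m"
  shows "power_sum E c x m = 0"
  unfolding power_sum_def
proof (rule mat_trace_odd[OF _ _ assms(4)])
  fix i j assume ij: "i \<in> idx E" "j \<in> idx E"
  have "to_form (chern_matrix E c x i j) = to_form (- chern_matrix E c x j i)"
    using curvature_skew[OF assms(1-3) ij] ij assms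
    by (auto intro!: form_eqI simp: to_form_simps to_form_chern_matrix)
  then show "chern_matrix E c x i j = - chern_matrix E c x j i" by (simp add: to_form_inject)
qed (use assms in \<open>simp add: regular_conn_def\<close>)

lemma to_form_tensor_sum:
  "to_form (tensor_sum A B i i' j j') = tensor_sum (\<lambda>i j. to_form (A i j)) (\<lambda>i j. to_form (B i j)) i i' j j'"
  by (simp add: tensor_sum_def delta_def to_form_simps)

lemma scl_tensor_sum:
  "scl r (tensor_sum A B i i' j j') = tensor_sum (\<lambda>i j. scl r (A i j)) (\<lambda>i j. scl r (B i j)) i i' j j'"
  by (auto intro!: form_eqI simp: tensor_sum_def delta_def distrib_left)

lemma power_sum_tensor:
  assumes c: "chart_at c x" and E: "regular_conn c x E" and F: "regular_conn c x F"
  shows "power_sum (tensor E F) c x m =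
    (\<Sum>k\<le>m. of_nat (m choose k) * power_sum E c x k * power_sum F c x (m - k))"
proof -
  have "chern_matrix (tensor E F) c x (prod_encode (i, i')) (prod_encode (j, j')) =
      tensor_sum (chern_matrix E c x) (chern_matrix F c x) i i' j j'"
    if ij: "i \<in> idx E" "i' \<in> idx F" "j \<in> idx E" "j' \<in> idx F" for i i' j j'
  proof (rule to_form_inject[THEN iffD1])
    have "to_form (chern_matrix (tensor E F) c x (prod_encode (i, i')) (prod_encode (j, j'))) =
        scl (\<i> / (2 * of_real pi)) (tensor_sum (curvature E c x) (curvature F c x) i i' j j')"
      using ij by (subst to_form_chern_matrix[OF c tensor_regular[OF E F]])
        (auto simp: idx_tensor curvature_tensor[OF c E F])
    then show "to_form (chern_matrix (tensor E F) c x (prod_encode (i, i')) (prod_encode (j, j'))) =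
        to_form (tensor_sum (chern_matrix E c x) (chern_matrix F c x) i i' j j')"
      using ij by (simp add: to_form_tensor_sum scl_tensor_sum)
        (simp add: tensor_sum_def to_form_chern_matrix c E F)
  qed
  then have "power_sum (tensor E F) c x m = mat_trace (prod_encode ` (idx E \<times> idx F))
      (unpair (tensor_sum (chern_matrix E c x) (chern_matrix F c x))) m"
    unfolding power_sum_def idx_tensor by (intro mat_trace_cong) auto
  with E F show ?thesis by (simp add: mat_trace_tensor regular_conn_def power_sum_def)
qed

lemma power_sum_ext2:
  assumes c: "chart_at c x" and E: "regular_conn c x E"
  shows "2 * power_sum (ext2 E) c x m =
    (\<Sum>k\<le>m. of_nat (m choose k) * power_sum E c x k * power_sum E c x (m - k)) - 2 ^ m * power_sum E c x m"
proof -
  have "chern_matrix (ext2 E) c x (prod_encode (i, i')) (prod_encode (j, j')) =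
      unpair_alt (tensor_sum (chern_matrix E c x) (chern_matrix E c x)) (prod_encode (i, i')) (prod_encode (j, j'))"
    if ij: "i \<in> idx E" "i' \<in> idx E" "i < i'" "j \<in> idx E" "j' \<in> idx E" "j < j'" for i i' j j'
  proof (rule to_form_inject[THEN iffD1])
    let ?W = "curvature E c x" and ?r = "\<i> / (2 * of_real pi)"
    have "to_form (chern_matrix (ext2 E) c x (prod_encode (i, i')) (prod_encode (j, j'))) =
        scl ?r (tensor_sum ?W ?W i i' j j' - tensor_sum ?W ?W i' i j j')"
      using ij curvature_ext2[OF c E ij(1,2,4,5)] by (subst to_form_chern_matrix[OF c ext2_regular[OF E]])
        (auto simp: idx_ext2)
    also have "\<dots> = scl ?r (tensor_sum ?W ?W i i' j j') - scl ?r (tensor_sum ?W ?W i' i j j')"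
      by (auto intro!: form_eqI simp: right_diff_distrib)
    finally show "to_form (chern_matrix (ext2 E) c x (prod_encode (i, i')) (prod_encode (j, j'))) =
        to_form (unpair_alt (tensor_sum (chern_matrix E c x) (chern_matrix E c x))
          (prod_encode (i, i')) (prod_encode (j, j')))"
      using ij by (simp add: to_form_tensor_sum scl_tensor_sum to_form_simps)
        (simp add: tensor_sum_def to_form_chern_matrix c E)
  qed
  then have "power_sum (ext2 E) c x m =
      mat_trace (prod_encode ` {(k, k'). k \<in> idx E \<and> k' \<in> idx E \<and> k < k'})
        (unpair_alt (tensor_sum (chern_matrix E c x) (chern_matrix E c x))) m"
    unfolding power_sum_def idx_ext2 by (intro mat_trace_cong) (auto simp del: unpair_alt_encode)
  with E show ?thesis by (simp add: mat_trace_ext2 regular_conn_def power_sum_def)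
qed

lemma power_sum_triv: "power_sum (triv n) c x m = (if m = 0 then of_nat n else 0)"
proof -
  have "chern_matrix (triv n) c x = (\<lambda>i j. 0)"
    by (auto simp: chern_matrix_def curvature_triv fun_eq_iff zero_eform_def scl_def zero_form_def)
  then show ?thesis
    by (cases m) (auto simp: power_sum_def mat_trace_def triv_def delta_def)
qed

definition trace_series ::
    "complex fps \<Rightarrow> ('x, 'n::{finite, linorder}, complex) vec_bundle \<Rightarrow> ('x, 'n coords) chart \<Rightarrow> 'x \<Rightarrow> 'n eform" where
  "trace_series f E c x = (\<Sum>m\<le>CARD('n). escl (fps_nth f m) (power_sum E c x m))"

lemma to_form_trace_series:
  assumes "chart_at c x" "regular_conn c x E"
  shows "to_form (trace_series f E c x) = trace_fps f E c x"
proof -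
  let ?W = "\<lambda>i j. scl (\<i> / (2 * of_real pi)) (curvature E c x i j)"
  have "to_form (mat_power (idx E) (chern_matrix E c x) m i j) = mat_power (idx E) ?W m i j"
    if "i \<in> idx E" for m i j
    using that by (induction m arbitrary: i)
      (simp_all add: delta_def to_form_simps to_form_sum to_form_chern_matrix[OF assms])
  then show ?thesis
    by (simp add: trace_series_def trace_fps_def Let_def to_form_sum to_form_simps power_sum_def mat_trace_def)
qed

lemma part_trace_series:
  fixes E :: "('x, 'n::{finite, linorder}, complex) vec_bundle"
  assumes "chart_at c x" "regular_conn c x E"
  shows "part k (trace_series f E c x) = escl (fps_nth f k) (power_sum E c x k)"
proof -
  \<comment> \<open>Beyond the cutoff of the series the power sum itself vanishes, since its degree
    2k exceeds the dimension. So the formula holds for all k.\<close>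
  have "power_sum E c x k = 0" if "\<not> k \<le> CARD('n)"
    using part_power_sum[OF assms, of k k] part_eq_0[of k "power_sum E c x k"] that by simp
  then show ?thesis
    by (auto simp: trace_series_def part_sum part_simps part_power_sum[OF assms] escl_simps
        if_distrib[of "escl _"] cong: if_cong)
qed

section \<open>The Chern character of virtual bundles\<close>

definition chern_character ::
    "('x, 'n::{finite, linorder}) virtual \<Rightarrow> ('x, 'n coords) chart \<Rightarrow> 'x \<Rightarrow> 'n eform" where
  "chern_character V c x = (\<Sum>(a, E)\<leftarrow>V. of_int a * trace_series (fps_exp 1) E c x)"

definition regular_virtual :: "('x, 'n::{finite, linorder} coords) chart \<Rightarrow> 'x \<Rightarrow> ('x, 'n) virtual \<Rightarrow> bool" where
  "regular_virtual c x V \<longleftrightarrow> (\<forall>(a, E)\<in>set V. regular_conn c x E)"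

lemma to_form_chern_character:
  assumes "chart_at c x" "regular_virtual c x V"
  shows "to_form (chern_character V c x) = ch V c x"
  using assms(2)
  by (induction V) (auto simp: regular_virtual_def chern_character_def ch_def to_form_simps
      to_form_of_int to_form_trace_series[OF assms(1)])

lemma regular_virtual_intros:
  "regular_conn c x E \<Longrightarrow> regular_virtual c x (vb E)"
  "regular_virtual c x (vint m)"
  "regular_virtual c x V \<Longrightarrow> regular_virtual c x (vscale m V)"
  "regular_virtual c x V \<Longrightarrow> regular_virtual c x W \<Longrightarrow> regular_virtual c x (V \<oplus>\<^sub>v W)"
  "regular_virtual c x V \<Longrightarrow> regular_virtual c x W \<Longrightarrow> regular_virtual c x (V \<ominus>\<^sub>v W)"
  "regular_virtual c x V \<Longrightarrow> regular_virtual c x W \<Longrightarrow> regular_virtual c x (V \<otimes>\<^sub>v W)"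
  "regular_conn c x E \<Longrightarrow> regular_virtual c x (vreduced E)"
  by (fastforce simp: regular_virtual_def vb_def vint_def vscale_def vplus_def vminus_def vtensor_def
      vreduced_def triv_regular intro: tensor_regular)+

lemma trace_series_triv: "trace_series f (triv n) c x = escl (fps_nth f 0) (of_nat n)"
  by (simp add: trace_series_def power_sum_triv if_distrib[of "escl _"] escl_simps cong: if_cong)

lemma chern_character_simps:
  "chern_character (vb E) c x = trace_series (fps_exp 1) E c x"
  "chern_character (vint m) c x = of_int m"
  "chern_character (V \<oplus>\<^sub>v W) c x = chern_character V c x + chern_character W c x"
  "chern_character (vscale m V) c x = of_int m * chern_character V c x"
  "chern_character (V \<ominus>\<^sub>v W) c x = chern_character V c x - chern_character W c x"
proof -
  show *: "chern_character (vscale m V) c x = of_int m * chern_character V c x" for m V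
    by (induction V) (auto simp: chern_character_def vscale_def distrib_left mult.assoc)
  show "chern_character (V \<ominus>\<^sub>v W) c x = chern_character V c x - chern_character W c x"
    using *[of "-1" W] by (simp add: vminus_def chern_character_def)
qed (simp_all add: chern_character_def vb_def vint_def vplus_def trace_series_triv escl_simps)

text \<open>Dividing the binomial formula for power sums by n! gives the weights 1/(k! (n-k)!), that
  is, the Cauchy product of two exponential series.\<close>

lemma trace_series_tensor:
  assumes "chart_at c x" "regular_conn c x E" "regular_conn c x F"
  shows "trace_series (fps_exp 1) (tensor E F) c x =
    trace_series (fps_exp 1) E c x * trace_series (fps_exp 1) F c x"
proof (rule part_eqI)
  fix n
  have "of_nat (n choose k) * escl (1 / fact n) a = escl (1 / (fact (n - k) * fact k)) a"
    if "k \<le> n" for k and a :: "'b eform"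
  proof -
    have "of_nat (n choose k) / fact n = (1 / (fact (n - k) * fact k) :: complex)"
      using that by (simp add: binomial_fact)
    then show ?thesis by (simp flip: escl_of_nat add: escl_simps)
  qed
  then show "part n (trace_series (fps_exp 1) (tensor E F) c x) =
      part n (trace_series (fps_exp 1) E c x * trace_series (fps_exp 1) F c x)"
    by (simp add: part_trace_series tensor_regular assms part_mult power_sum_tensor escl_sum escl_simps
        mult.assoc)
qed

lemma chern_character_tensor:
  assumes c: "chart_at c x" and "regular_virtual c x V" "regular_virtual c x W"
  shows "chern_character (V \<otimes>\<^sub>v W) c x = chern_character V c x * chern_character W c x"
  using assms(2)
proof (induction V)
  case Nil
  show ?case by (simp add: vtensor_def chern_character_def)
next
  case (Cons p V)
  obtain a E where p: "p = (a, E)" by force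
  have E: "regular_conn c x E" using Cons.prems by (simp add: regular_virtual_def p)
  have "chern_character (map (\<lambda>(b, F). (a * b, tensor E F)) W) c x =
      of_int a * trace_series (fps_exp 1) E c x * chern_character W c x"
    using assms(3)
    by (induction W) (auto simp: chern_character_def regular_virtual_def trace_series_tensor[OF c E]
        algebra_simps)
  moreover have "chern_character (p # V) c x =
      of_int a * trace_series (fps_exp 1) E c x + chern_character V c x"
    by (simp add: chern_character_def p)
  moreover have "chern_character ((p # V) \<otimes>\<^sub>v W) c x =
      chern_character (map (\<lambda>(b, F). (a * b, tensor E F)) W) c x + chern_character (V \<otimes>\<^sub>v W) c x"
    by (simp add: vtensor_def p chern_character_def)
  ultimately show ?case
    using Cons by (simp add: regular_virtual_def algebra_simps)
qed

lemma chern_character_reduced: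
  "chern_character (vreduced E) c x = trace_series (fps_exp 1) E c x - of_nat (card (idx E))"
  by (simp add: vreduced_def chern_character_simps)

section \<open>Characteristic power series\<close>

text \<open>The logarithmic derivative with denominators cleared. Comparing coefficients gives a
  recursion for log f, so the composition is never expanded.\<close>

lemma fps_deriv_log:
  fixes f :: "complex fps"
  assumes "fps_nth f 0 = 1"
  shows "f * fps_deriv (fps_ln 1 oo (f - 1)) = fps_deriv f"
proof -
  have f: "fps_nth (f - 1) 0 = 0" using assms by simp
  have "(1 + fps_X) * fps_deriv (fps_ln 1) = (1 :: complex fps)"
    using inverse_mult_eq_1'[of "1 + fps_X :: complex fps"] by (simp add: fps_ln_deriv)
  then have "((1 + fps_X) * fps_deriv (fps_ln 1)) oo (f - 1) = 1" by simp
  then have "f * (fps_deriv (fps_ln 1) oo (f - 1)) = 1"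
    by (simp add: fps_compose_mult_distrib[OF f] fps_compose_add_distrib assms)
  then show ?thesis
    by (simp add: fps_compose_deriv[OF f] flip: mult.assoc)
qed

lemma fps_log_nth_0: "fps_nth (fps_ln 1 oo g :: complex fps) 0 = 0"
  by (simp add: fps_ln_def)

text \<open>The second factor is sinh(X/2) / (X/2). Numerator and denominator of
  \<open>Ahat_fps\<close> share a factor X/2, and what remains of the denominator has constant term
  1, so it is invertible.\<close>

lemma Ahat_fps_times:
  "Ahat_fps * Abs_fps (\<lambda>n. ((1 / 2) ^ (n + 1) - (- (1 / 2)) ^ (n + 1)) / fact (n + 1)) = 1"
proof -
  define U :: "complex fps" where
    "U = Abs_fps (\<lambda>n. ((1 / 2) ^ (n + 1) - (- (1 / 2)) ^ (n + 1)) / fact (n + 1))"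
  have U0: "fps_nth U 0 \<noteq> 0" by (simp add: U_def)
  have "fps_exp (1 / 2) - fps_exp (- (1 / 2)) = fps_X * U"
  proof (rule fps_ext)
    fix n show "fps_nth (fps_exp (1 / 2) - fps_exp (- (1 / 2))) n = fps_nth (fps_X * U) n"
      by (cases n) (simp_all add: U_def diff_divide_distrib del: fact_Suc power_Suc)
  qed
  then have "Ahat_fps = (fps_const (1 / 2) * fps_X) / (fps_const (1 / 2) * fps_X * U)"
    by (simp add: Ahat_fps_def mult.assoc)
  moreover have "fps_const (1 / 2) * fps_X = (fps_const (1 / 2) * fps_X * U) * inverse U"
    using U0 by (simp add: mult.assoc inverse_mult_eq_1')
  moreover have "\<dots> / (fps_const (1 / 2) * fps_X * U) = inverse U"
    using U0 by (intro nonzero_mult_div_cancel_left) auto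
  ultimately have "Ahat_fps = inverse U" by simp
  then have "Ahat_fps * U = 1" using inverse_mult_eq_1[OF U0] by simp
  then show ?thesis unfolding U_def .
qed

lemma Ahat_fps_nth:
  "fps_nth Ahat_fps 0 = 1" "fps_nth Ahat_fps (Suc 0) = 0" "fps_nth Ahat_fps 2 = - 1 / 24"
  "fps_nth Ahat_fps 3 = 0" "fps_nth Ahat_fps 4 = 7 / 5760" "fps_nth Ahat_fps 5 = 0"
  "fps_nth Ahat_fps 6 = - 31 / 967680"
proof -
  note c = arg_cong[OF Ahat_fps_times, of "\<lambda>f. fps_nth f n" for n, unfolded fps_mult_nth]
  show 0: "fps_nth Ahat_fps 0 = 1" using c[of 0] by simp
  show 1: "fps_nth Ahat_fps (Suc 0) = 0" using c[of 1] 0 by (simp add: eval_nat_numeral)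
  show 2: "fps_nth Ahat_fps 2 = - 1 / 24"
    using c[of 2] 0 1 by (simp add: atLeast0_atMost_Suc numeral_eq_Suc eq_neg_iff_add_eq_0)
  show 3: "fps_nth Ahat_fps 3 = 0"
    using c[of 3] 0 1 2 by (simp add: atLeast0_atMost_Suc numeral_eq_Suc)
  show 4: "fps_nth Ahat_fps 4 = 7 / 5760"
    using c[of 4] 0 1 2 3 by (simp add: atLeast0_atMost_Suc numeral_eq_Suc)
  show 5: "fps_nth Ahat_fps 5 = 0"
    using c[of 5] 0 1 2 3 4 by (simp add: atLeast0_atMost_Suc numeral_eq_Suc)
  show "fps_nth Ahat_fps 6 = - 31 / 967680"
  proof -
    \<comment> \<open>The constant is (- 1/24) (1/1920) + 1/322560 = - 1/53760, from the
      coefficients of X^4 and X^6 in the second factor.\<close>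
    have "fps_nth Ahat_fps 6 + (fps_nth Ahat_fps 4 / 24 - 1 / 53760) = 0"
      using c[of 6] 0 1 2 3 5 by (simp add: atLeast0_atMost_Suc numeral_eq_Suc)
    from this[unfolded 4] show ?thesis by (simp add: eq_neg_iff_add_eq_0)
  qed
qed

text \<open>The coefficients are - B_2k / (2k (2k)!) for Bernoulli numbers B_2k, obtained here from
  the recursion of \<open>fps_deriv_log\<close>.\<close>

lemma log_Ahat_fps_nth:
  defines "L \<equiv> fps_ln 1 oo (Ahat_fps - 1)"
  shows "fps_nth L 0 = 0" "fps_nth L 2 = - 1 / 24" "fps_nth L 4 = 1 / 2880" "fps_nth L 6 = - 1 / 181440"
proof -
  note c = arg_cong[OF fps_deriv_log[OF Ahat_fps_nth(1)], folded L_def, of "\<lambda>f. fps_nth f n" for n,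
    unfolded fps_mult_nth fps_deriv_nth]
  show "fps_nth L 0 = 0" unfolding L_def by (rule fps_log_nth_0)
  have 1: "fps_nth L 1 = 0" using c[of 0] by (simp add: Ahat_fps_nth)
  have 2: "fps_nth L 2 = - 1 / 24" using c[of 1] 1 Ahat_fps_nth by (simp add: eval_nat_numeral)
  have 3: "fps_nth L 3 = 0" using c[of 2] 1 2 Ahat_fps_nth by (simp add: atLeast0_atMost_Suc eval_nat_numeral)
  have "4 * fps_nth L 4 + fps_nth Ahat_fps 2 * (2 * fps_nth L 2) = 4 * fps_nth Ahat_fps 4"
    using c[of 3] 1 3 Ahat_fps_nth(1,2,4) by (simp add: atLeast0_atMost_Suc eval_nat_numeral algebra_simps)
  from this[unfolded 2 Ahat_fps_nth] have 4: "fps_nth L 4 = 1 / 2880"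
    by (simp add: field_simps)
  have 5: "fps_nth L 5 = 0" using c[of 4] 1 3 Ahat_fps_nth(1,2,4,6)
    by (simp add: atLeast0_atMost_Suc eval_nat_numeral)
  have "6 * fps_nth L 6 + fps_nth Ahat_fps 2 * (4 * fps_nth L 4) + fps_nth Ahat_fps 4 * (2 * fps_nth L 2) =
      6 * fps_nth Ahat_fps 6"
    using c[of 5] 1 3 5 Ahat_fps_nth(1,2,4,6) by (simp add: atLeast0_atMost_Suc eval_nat_numeral algebra_simps)
  then have "fps_nth L 6 = fps_nth Ahat_fps 6 -
      (fps_nth Ahat_fps 2 * (4 * fps_nth L 4) + fps_nth Ahat_fps 4 * (2 * fps_nth L 2)) / 6"
    by (simp add: field_simps)
  from this[unfolded 2 4 Ahat_fps_nth] have 6: "fps_nth L 6 = - 1 / 181440"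
    by simp
  show "fps_nth L 2 = - 1 / 24" "fps_nth L 4 = 1 / 2880" "fps_nth L 6 = - 1 / 181440"
    by (fact 2 4 6)+
qed

text \<open>These coefficients identify p_1 with t_2 / 2: the roots occur in pairs, so the sum of
  the y_j^2 is half the second power sum.\<close>

lemma log_one_plus_square_nth:
  "fps_nth (fps_ln 1 oo (1 + fps_X ^ 2 - 1) :: complex fps) 0 = 0"
  "fps_nth (fps_ln 1 oo (1 + fps_X ^ 2 - 1) :: complex fps) 2 = 1"
proof -
  define L :: "complex fps" where "L = fps_ln 1 oo (1 + fps_X ^ 2 - 1)"
  have "(1 + fps_X ^ 2) * fps_deriv L = fps_deriv (1 + fps_X ^ 2)"
    unfolding L_def by (rule fps_deriv_log) simp
  then have "fps_nth ((1 + fps_X ^ 2) * fps_deriv L) 1 = fps_nth (fps_deriv (1 + fps_X ^ 2)) 1"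
    by simp
  then have "fps_nth L 2 = 1"
    by (simp add: distrib_right fps_X_power_mult_nth fps_X_power_nth numeral_2_eq_2)
  then show "fps_nth (fps_ln 1 oo (1 + fps_X ^ 2 - 1) :: complex fps) 2 = 1"
    by (simp only: L_def)
qed (rule fps_log_nth_0)


section \<open>Exponentials in low degrees\<close>

lemma part_mult_low:
  "part 0 (a * b) = part 0 a * part 0 b"
  "part (Suc 0) (a * b) = part 0 a * part (Suc 0) b + part (Suc 0) a * part 0 b"
  "part 2 (a * b) = part 0 a * part 2 b + part (Suc 0) a * part (Suc 0) b + part 2 a * part 0 b"
  "part 3 (a * b) = part 0 a * part 3 b + part (Suc 0) a * part 2 b + part 2 a * part (Suc 0) b + part 3 a * part 0 b"
  "part 4 (a * b) = part 0 a * part 4 b + part (Suc 0) a * part 3 b + part 2 a * part 2 b + part 3 a * part (Suc 0) b +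
    part 4 a * part 0 b"
  "part 5 (a * b) = part 0 a * part 5 b + part (Suc 0) a * part 4 b + part 2 a * part 3 b + part 3 a * part 2 b +
    part 4 a * part (Suc 0) b + part 5 a * part 0 b"
  "part 6 (a * b) = part 0 a * part 6 b + part (Suc 0) a * part 5 b + part 2 a * part 4 b + part 3 a * part 3 b +
    part 4 a * part 2 b + part 5 a * part (Suc 0) b + part 6 a * part 0 b"
  by (simp_all add: part_mult eval_nat_numeral)

lemma escl_power: "escl r a ^ m = escl (r ^ m) (a ^ m)"
  by (induction m) (auto simp: escl_simps power_commutes)

lemma escl_numeral_mult: "escl r (numeral k * a) = escl (r * numeral k) a"
  by (simp flip: escl_numeral add: escl_simps)

text \<open>An exponent starting in degree 4 has its fourth power in degree 16 or higher, so only
  powers up to the cube reach degree 12.\<close>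

lemma part_exp:
  assumes a: "part 0 a = 0" "part (Suc 0) a = 0" "part 3 a = 0" "part 5 a = 0"
  shows "part 0 (efps (fps_exp 1) a) = 1" "part (Suc 0) (efps (fps_exp 1) a) = 0"
    "part 2 (efps (fps_exp 1) a) = part 2 a" "part 3 (efps (fps_exp 1) a) = 0"
    "part 4 (efps (fps_exp 1) a) = part 4 a + escl (1 / 2) (part 2 a * part 2 a)"
    "part 5 (efps (fps_exp 1) a) = 0"
    "part 6 (efps (fps_exp 1) a) =
      part 6 a + part 2 a * part 4 a + escl (1 / 6) (part 2 a * part 2 a * part 2 a)"
proof -
  have a': "part i a = 0" if "i < 2" for i using a that by (cases i) auto
  have *: "part k (efps (fps_exp 1) a) = (\<Sum>m\<le>3. escl (1 / fact m) (part k (a ^ m)))" if "k \<le> 6" for k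
  proof -
    have "part k (efps (fps_exp 1) a) = (\<Sum>m\<le>6. escl (1 / fact m) (part k (a ^ m)))"
      using part_efps[OF a(1) that] by simp
    also have "\<dots> = (\<Sum>m\<le>3. escl (1 / fact m) (part k (a ^ m)))"
      using that by (intro sum.mono_neutral_right) (auto simp: part_power_eq_0[of 2] a' escl_simps)
    finally show ?thesis .
  qed
  have 3: "{..3} = {0, 1, 2, 3 :: nat}" by auto
  show "part 0 (efps (fps_exp 1) a) = 1" "part (Suc 0) (efps (fps_exp 1) a) = 0"
    "part 2 (efps (fps_exp 1) a) = part 2 a" "part 3 (efps (fps_exp 1) a) = 0"
    "part 4 (efps (fps_exp 1) a) = part 4 a + escl (1 / 2) (part 2 a * part 2 a)"
    "part 5 (efps (fps_exp 1) a) = 0"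
    "part 6 (efps (fps_exp 1) a) =
      part 6 a + part 2 a * part 4 a + escl (1 / 6) (part 2 a * part 2 a * part 2 a)"
    by (simp_all add: * 3 part_mult_low part_one a power2_eq_square power3_eq_cube fact_numeral escl_simps
        escl_numeral_mult mult_ac)
qed

text \<open>For e^(c/2) the exponent has degree 2, outside the scope of \<open>part_exp\<close>. It
  is homogeneous, so each power occupies exactly one degree.\<close>

lemma part_exp_2_form:
  assumes e: "\<And>k. k \<noteq> 1 \<Longrightarrow> part k e = 0"
  shows "part k (efps (fps_exp 1) (escl r e)) = escl (r ^ k / fact k) (e ^ k)"
proof -
  have e': "part (Suc 0) e = e" by (rule part_eqI) (use e in \<open>auto simp: part_part\<close>)
  have pw: "part l (e ^ m) = (if l = m then e ^ m else 0)" for l m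
  proof (induction m arbitrary: l)
    case (Suc m)
    have "part l (e ^ Suc m) = (\<Sum>i\<le>l. if i = 1 then e * part (l - 1) (e ^ m) else 0)"
      unfolding power_Suc part_mult by (rule sum.cong) (use e e' in auto)
    then show ?case using Suc by (cases l) auto
  qed (auto simp: part_one)
  have "part 0 (escl r e) = 0" using e by (simp add: part_simps escl_simps)
  then show ?thesis
    by (simp add: escl_power part_efps[of _ k k] part_simps pw escl_simps if_distrib[of "escl _"] cong: if_cong)
qed

lemma exp_quotient:
  assumes "part 0 (P :: 'n::{finite, linorder} eform) = 0"
  shows "P * efps exp_quotient_fps P = efps (fps_exp 1) (escl (1 / 24) P) - 1"
proof -
  \<comment> \<open>The sum is prolonged by one vanishing term, so that after splitting off k = 0 it
    matches \<open>P\<close> times the quotient series term by term.\<close>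
  have "efps (fps_exp 1) (escl (1 / 24) P) = (\<Sum>k\<le>Suc CARD('n). escl (1 / (24 ^ k * fact k)) (P ^ k))"
    by (subst efps_extend[where M = "Suc CARD('n)"])
      (simp_all add: assms part_simps escl_simps escl_power power_divide mult.commute)
  also have "\<dots> = 1 + P * efps exp_quotient_fps P"
    by (subst sum.atMost_Suc_shift)
      (simp add: efps_def exp_quotient_fps_def sum_distrib_left escl_simps mult.assoc del: fact_Suc power_Suc flip: power_Suc)
  finally show ?thesis by simp
qed


section \<open>Genera and the Euler class\<close>

definition genus_series ::
    "complex fps \<Rightarrow> ('x, 'n::{finite, linorder}, real) vec_bundle \<Rightarrow> ('x, 'n coords) chart \<Rightarrow> 'x \<Rightarrow> 'n eform" where
  "genus_series f E c x =
    efps (fps_exp 1) (escl (1 / 2) (trace_series (fps_ln 1 oo (f - 1)) (complexify E) c x))"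

lemma to_form_genus_series:
  assumes "chart_at c x" "regular_conn c x E"
  shows "to_form (genus_series f E c x) = genus f E c x"
  using assms by (simp add: genus_series_def genus_def exp_form_def to_form_efps to_form_simps
      to_form_trace_series complexify_regular)

text \<open>The exponent has parts L_k t_k / 2. Those with odd k vanish by skew symmetry whatever
  \<open>f\<close> is, and L_0 = 0, so \<open>part_exp\<close> applies.\<close>

lemma part_genus_series:
  fixes f :: "complex fps"
  assumes "chart_at c x" "regular_conn c x E" "skew_conn c E"
  defines "L \<equiv> fps_ln 1 oo (f - 1)" and "t \<equiv> power_sum (complexify E) c x"
  shows "part 0 (genus_series f E c x) = 1" "part (Suc 0) (genus_series f E c x) = 0"
    "part 2 (genus_series f E c x) = escl (fps_nth L 2 / 2) (t 2)" "part 3 (genus_series f E c x) = 0"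
    "part 4 (genus_series f E c x) =
      escl (fps_nth L 4 / 2) (t 4) + escl (fps_nth L 2 ^ 2 / 8) (t 2 * t 2)"
    "part 5 (genus_series f E c x) = 0"
    "part 6 (genus_series f E c x) =
      escl (fps_nth L 6 / 2) (t 6) + escl (fps_nth L 2 * fps_nth L 4 / 4) (t 2 * t 4) +
        escl (fps_nth L 2 ^ 3 / 48) (t 2 * t 2 * t 2)"
proof -
  let ?a = "escl (1 / 2) (trace_series L (complexify E) c x)"
  have p: "part k ?a = escl (fps_nth L k / 2) (t k)" for k
    using assms(1,2) by (simp add: part_simps part_trace_series complexify_regular escl_simps t_def)
  have odd: "t k = 0" if "odd k" for k
    unfolding t_def
    by (rule power_sum_odd[OF assms(1) complexify_regular[OF assms(2)] complexify_skew[OF assms(3)] that])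
  have a: "part 0 ?a = 0" "part (Suc 0) ?a = 0" "part 3 ?a = 0" "part 5 ?a = 0"
    by (simp_all add: p odd escl_simps) (simp add: L_def fps_log_nth_0 escl_simps)
  note e = part_exp[OF a, unfolded p]
  show "part 0 (genus_series f E c x) = 1" "part (Suc 0) (genus_series f E c x) = 0"
    "part 2 (genus_series f E c x) = escl (fps_nth L 2 / 2) (t 2)" "part 3 (genus_series f E c x) = 0"
    "part 4 (genus_series f E c x) =
      escl (fps_nth L 4 / 2) (t 4) + escl (fps_nth L 2 ^ 2 / 8) (t 2 * t 2)"
    "part 5 (genus_series f E c x) = 0"
    "part 6 (genus_series f E c x) =
      escl (fps_nth L 6 / 2) (t 6) + escl (fps_nth L 2 * fps_nth L 4 / 4) (t 2 * t 4) +
        escl (fps_nth L 2 ^ 3 / 48) (t 2 * t 2 * t 2)"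
    unfolding genus_series_def L_def[symmetric]
    by (simp_all add: e escl_simps power2_eq_square power3_eq_cube mult_ac)
qed

lemma p1_eq_power_sum:
  assumes "chart_at c x" "regular_conn c x E" "skew_conn c E"
  shows "p1 E c x = to_form (escl (1 / 2) (power_sum (complexify E) c x 2))"
  using part_genus_series(3)[OF assms, of "1 + fps_X ^ 2"] to_form_genus_series[OF assms(1,2), of "1 + fps_X ^ 2"]
    part.rep_eq[of 2 "genus_series (1 + fps_X ^ 2) E c x"] log_one_plus_square_nth(2)
  by (simp add: p1_def)

definition euler_class ::
    "('x, 'n::{finite, linorder}, real) vec_bundle \<Rightarrow> ('x, 'n coords) chart \<Rightarrow> 'x \<Rightarrow> 'n eform" where
  "euler_class E c x = of_form (euler_form E c x)"

lemma euler_class: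
  assumes c: "chart_at c x" and E: "regular_conn c x E" "idx E = {..<2}"
  shows "to_form (euler_class E c x) = euler_form E c x"
    and "k \<noteq> 1 \<Longrightarrow> part k (euler_class E c x) = 0"
proof -
  have h: "homogeneous 2 (euler_form E c x)"
    using homogeneous_curvature[OF c E(1), of 0 1] E(2)
    by (simp add: euler_form_def homogeneous_def cplx_form_def)
  then show 1: "to_form (euler_class E c x) = euler_form E c x"
    unfolding euler_class_def by (intro to_form_of_form homogeneous_even[of 2]) auto
  show "part k (euler_class E c x) = 0" if "k \<noteq> 1"
    using h that
    by (intro to_form_inject[THEN iffD1] form_eqI) (simp add: to_form_simps 1 homogeneous_def)
qed

text \<open>The matrix of an oriented plane bundle is \<open>W = ((0, \<i>c), (-\<i>c, 0))\<close>, so \<open>W\<^sup>2 = c\<^sup>2\<close>.\<close>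

lemma power_sum_plane:
  assumes c: "chart_at c x" and E: "regular_conn c x E" "skew_conn c E" "idx E = {..<2}"
  shows "power_sum (complexify E) c x (2 * k) = 2 * euler_class E c x ^ (2 * k)"
proof -
  let ?W = "chern_matrix (complexify E) c x" and ?e = "euler_class E c x" and ?\<Omega> = "curvature E c x"
  have toW: "to_form (?W i j) = scl (\<i> / (2 * of_real pi)) (cplx_form (?\<Omega> i j))" if "i < 2" "j < 2" for i j
    using that to_form_chern_matrix[OF c complexify_regular[OF E(1)], of i j] E(3)
      curvature_complexify[OF E(1), of i j] by simp
  have sk: "?\<Omega> i j = - ?\<Omega> j i" if "i < 2" "j < 2" for i j
    using curvature_skew[OF c E(1,2), of i j] that E(3) by simp
  have "?\<Omega> i i = 0" if "i < 2" for i
  proof (rule form_eqI)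
    fix I show "coeff (?\<Omega> i i) I = coeff 0 I"
      using arg_cong[OF sk[OF that that], of "\<lambda>a. coeff a I"] by simp
  qed
  then have W0: "?W 0 0 = 0" "?W 1 1 = 0"
    by (auto intro!: to_form_inject[THEN iffD1] form_eqI simp: toW cplx_form_simps to_form_simps)
  have W1: "?W 0 1 = escl \<i> ?e"
    by (rule to_form_inject[THEN iffD1])
      (simp add: toW to_form_simps euler_class[OF c E(1,3)] euler_form_def cplx_form_simps,
       auto intro!: form_eqI)
  have W2: "?W 1 0 = - escl \<i> ?e"
    using sk[of 1 0]
    by (intro to_form_inject[THEN iffD1])
      (simp add: toW to_form_simps euler_class[OF c E(1,3)] euler_form_def cplx_form_simps,
       auto intro!: form_eqI)
  have sum2: "(\<Sum>l<2. f l) = f 0 + f 1" for f :: "nat \<Rightarrow> 'b eform"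
    by (simp add: numeral_2_eq_2)
  have step: "mat_power {..<2} ?W (Suc (Suc m)) i j = ?e * ?e * mat_power {..<2} ?W m i j" if "i < 2" for m i j
  proof -
    have "i = 0 \<or> i = 1" using that by auto
    then show ?thesis
      by (elim disjE; simp only: mat_power.simps sum2 W0 W1 W2) (simp_all add: escl_simps mult.assoc)
  qed
  have "mat_power {..<2} ?W (2 * k) i j = ?e ^ (2 * k) * delta i j" if "i < 2" for i j
    by (induction k) (simp_all add: step[OF that] mult.assoc del: mat_power.simps(2))
  then show ?thesis by (simp add: power_sum_def mat_trace_def E(3) delta_def)
qed

lemma eform_double_cancel:
  assumes "2 * a = 2 * b"
  shows "a = (b :: 'n::{finite, linorder} eform)"
  using arg_cong[OF assms, of "escl (1 / 2)"] by (simp add: escl_numeral_mult escl_simps)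

text \<open>The end terms k = 0 and k = m of the binomial sum give 2 n p_m. After subtracting 2^m
  p_m and halving, p_m has coefficient n - 2^(m-1), hence 2, 8 and 32. Middle terms with odd index
  vanish.\<close>

lemma power_sum_ext2_low:
  assumes "chart_at c x" "regular_conn c x E" "skew_conn c E"
  defines "q \<equiv> power_sum (ext2 E) c x" and "p \<equiv> power_sum E c x"
  defines "n \<equiv> of_nat (card (idx E))"
  shows "odd k \<Longrightarrow> q k = 0"
    "2 * q 0 = n * (n - 1)"
    "q 2 = (n - 2) * p 2"
    "q 4 = (n - 8) * p 4 + 3 * (p 2 * p 2)"
    "q 6 = (n - 32) * p 6 + 15 * (p 2 * p 4)"
proof -
  have q: "2 * q k = (\<Sum>l\<le>k. of_nat (k choose l) * p l * p (k - l)) - 2 ^ k * p k" for k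
    unfolding q_def p_def by (rule power_sum_ext2[OF assms(1,2)])
  have odd: "p k = 0" if "odd k" for k
    unfolding p_def by (rule power_sum_odd[OF assms(1-3) that])
  have p0: "p 0 = n" by (simp add: p_def n_def power_sum_0)
  have p1: "p (Suc 0) = 0" "p 3 = 0" "p 5 = 0" by (simp_all add: odd)
  have atMost: "{..2} = {0, 1, 2 :: nat}" "{..4} = {0, 1, 2, 3, 4 :: nat}"
    "{..6} = {0, 1, 2, 3, 4, 5, 6 :: nat}" by auto
  have binom: "4 choose 2 = (6 :: nat)" "6 choose 2 = (15 :: nat)" "6 choose 4 = (15 :: nat)"
    by (simp_all add: eval_nat_numeral)
  show "q k = 0" if "odd k"
  proof -
    have "of_nat (k choose l) * p l * p (k - l) = 0" if "l \<le> k" for l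
      using odd[of l] odd[of "k - l"] \<open>odd k\<close> that by (cases "odd l") auto
    then have "2 * q k = 2 * 0" using that by (simp add: q odd)
    then show ?thesis by (rule eform_double_cancel)
  qed
  show "2 * q 0 = n * (n - 1)" unfolding q by (simp add: p0 algebra_simps)
  show "q 2 = (n - 2) * p 2"
    by (rule eform_double_cancel) (simp add: q atMost p0 p1 algebra_simps)
  show "q 4 = (n - 8) * p 4 + 3 * (p 2 * p 2)"
    by (rule eform_double_cancel) (simp add: q atMost p0 p1 binom algebra_simps)
  show "q 6 = (n - 32) * p 6 + 15 * (p 2 * p 4)"
    by (rule eform_double_cancel) (simp add: q atMost p0 p1 binom algebra_simps)
qed


section \<open>The anomaly cancellation formula\<close>

text \<open>With \<open>D = 10080\<close>, the variables stand for \<open>t_2k / D^k\<close>, \<open>p_2k / D^k\<close> and \<open>y = c^2 / D\<close>, where \<open>t_k\<close>, \<open>p_k\<close> are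
  the power sums of \<open>TZ\<close> and \<open>F\<close>; the scaling makes all coefficients integers.\<close>

lemma cancellation_identity:
  fixes x2 x4 x6 p2 p4 p6 y :: "'n::{finite, linorder} eform"
  assumes A: "part 0 A = 1" "part (Suc 0) A = 0" "part 2 A = - (210 * x2)" "part 3 A = 0"
      "part 4 A = 17640 * x4 + 22050 * (x2 * x2)" "part 5 A = 0"
      "part 6 A = - (2822400 * x6) - 3704400 * (x2 * x4) - 1543500 * (x2 * x2 * x2)"
    and R: "part 0 R = 1" "part (Suc 0) R = 0" "part 2 R = 210 * (x2 - p2)" "part 3 R = 0"
      "part 4 R = 22050 * ((x2 - p2) * (x2 - p2))" "part 5 R = 0"
      "part 6 R = 1543500 * ((x2 - p2) * (x2 - p2) * (x2 - p2))"
    and E: "part 0 E = 1" "part 2 E = 1260 * y" "part 4 E = 264600 * (y * y)"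
      "part 6 E = 22226400 * (y * y * y)"
    and T: "part 0 T = 10" "part (Suc 0) T = 0" "part 2 T = 5040 * x2" "part 3 T = 0"
      "part 4 T = 4233600 * x4" "part 5 T = 0" "part 6 T = 1422489600 * x6"
    and F: "part 0 F = 32" "part (Suc 0) F = 0" "part 2 F = 5040 * p2" "part 3 F = 0"
      "part 4 F = 4233600 * p4" "part 5 F = 0" "part 6 F = 1422489600 * p6"
    and L: "part 0 L = 496" "part (Suc 0) L = 0" "part 2 L = 151200 * p2" "part 3 L = 0"
      "part 4 L = 101606400 * p4 + 12700800 * (p2 * p2)" "part 5 L = 0"
      "part 6 L = 21337344000 * (p2 * p4)"
    and S: "part 0 S = 0" "part (Suc 0) S = 0" "part 2 S = 10080 * y" "part 3 S = 0"
      "part 4 S = 8467200 * (y * y)" "part 5 S = 0" "part 6 S = 2844979200 * (y * y * y)"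
    and P: "part 0 P = 0" "part (Suc 0) P = 0" "part 2 P = 5040 * (x2 - p2)" "part 3 P = 0" "part 4 P = 0"
      "part 5 P = 0" "part 6 P = 0"
  shows "part 6 (R * A * E * (L + T - 2 + 5 * (S * S) + 3 * ((1 - F) * S) - P)) = 0"
  \<comment> \<open>Parts of \<open>E\<close> with odd index are not prescribed: in half-degree 6
    each of them meets a vanishing part of odd index in another factor. What is left is a polynomial
    identity with integer coefficients.\<close>
  by (simp add: part_mult_low part_simps part_one part_numeral assms) (simp add: algebra_simps)

lemma part_numeral_mult: "part k (numeral n * a) = numeral n * part k a"
  by (simp flip: escl_numeral add: part_simps)

lemma to_form_numeral: "to_form (numeral n) = numeral n"
  using to_form_of_int[of "numeral n"] by simp

text \<open>\<open>P\<close> is homogeneous of degree 4, so it carries degree 8 to degree 12 and can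
  be taken out of the component. \<open>A\<close>, \<open>E\<close> and \<open>G\<close> are
  arbitrary, which covers both formulas of the theorem.\<close>

lemma anomaly_factorization:
  assumes P: "\<And>k. k \<noteq> 2 \<Longrightarrow> part k P = 0" and Q: "P * Q = R - 1"
    and 0: "part 6 (R * A * E * (G - P)) = 0"
  shows "part 6 (A * E * G) = P * part 4 (- Q * A * E * G + R * A * E)"
proof -
  have P2: "part 2 P = P" by (rule part_eqI) (use P in \<open>auto simp: part_part\<close>)
  have "P * (- Q * A * E * G + R * A * E) = - (P * Q) * (A * E * G) + R * A * E * P"
    by (simp add: algebra_simps)
  also have "\<dots> = A * E * G - R * A * E * (G - P)"
    by (simp add: Q algebra_simps)
  finally have "part 6 (P * (- Q * A * E * G + R * A * E)) = part 6 (A * E * G)"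
    using 0 by (simp add: part_simps)
  moreover have "part 6 (P * Z) = P * part 4 Z" for Z
    by (simp add: part_mult_low P P2)
  ultimately show ?thesis by simp
qed

theorem corollary3:
  fixes AX :: "('x::{t2_space, second_countable_topology}, 'n::{finite, linorder} coords) chart set"
    and AB :: "('b::{t2_space, second_countable_topology}, 'm::real_normed_vector) chart set"
    and AZ :: "('z::{t2_space, second_countable_topology}, real ^ 10) chart set"
    and \<pi> :: "'x \<Rightarrow> 'b"
    and g :: "('x, 'n coords) chart \<Rightarrow> 'x \<Rightarrow> 'n coords \<Rightarrow> 'n coords \<Rightarrow> real"
    and e :: "('x, 'n coords) chart \<Rightarrow> 'x \<Rightarrow> nat \<Rightarrow> 'n coords"
    and TZ F \<xi> :: "('x, 'n, real) vec_bundle"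
  assumes finite_dim_base: "\<exists>S :: 'm set. finite S \<and> span S = UNIV"
    and fibration: "fibre_bundle AX AB AZ \<pi>"
    and metric: "vertical_metric AX AB \<pi> g"
    and TZ: "vertical_tangent_bundle AX AB \<pi> g 10 e TZ"
    and LC: "levi_civita AX 10 e TZ"
    and F: "euclidean_bundle AX 32 F"
    and \<xi>: "oriented_plane_bundle AX \<xi>"
  shows
    "\<forall>c\<in>AX. \<forall>x\<in>chart_dom c.
      (let A = Ahat TZ c x;
           ec2 = exp_form (scl (1 / 2) (euler_form \<xi> c x));
           P = p1 TZ c x - p1 F c x;
           TC = vb (complexify TZ);
           FC = vb (complexify F);
           \<Lambda>2F = vb (ext2 (complexify F));
           \<xi>r = vreduced (complexify \<xi>);
           \<GG> = \<Lambda>2F \<oplus>\<^sub>v TC \<ominus>\<^sub>v vint 2 \<oplus>\<^sub>v vscale 5 (\<xi>r \<otimes>\<^sub>v \<xi>r)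
                \<oplus>\<^sub>v vscale 3 ((vint 1 \<ominus>\<^sub>v FC) \<otimes>\<^sub>v \<xi>r)
       in
        component 12 (A * ec2 * ch \<Lambda>2F c x)
          + component 12 (A * ec2 * ch TC c x)
          - 2 * component 12 (A * ec2)
          + 5 * component 12 (A * ec2 * ch (\<xi>r \<otimes>\<^sub>v \<xi>r) c x)
          + 3 * component 12 (A * ec2 * ch ((vint 1 \<ominus>\<^sub>v FC) \<otimes>\<^sub>v \<xi>r) c x)
        = P * component 8
            (- fps_form exp_quotient_fps P * A * ec2 * ch \<GG> c x
             + exp_form (scl (1 / 24) P) * A * ec2)
        \<and>
        (trivial_bundle AX 2 \<xi> \<longrightarrow>
          component 12 (A * ch \<Lambda>2F c x)
            + component 12 (A * ch TC c x)
            - 2 * component 12 A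
          = P * component 8
              (- fps_form exp_quotient_fps P * A * ch (\<Lambda>2F \<oplus>\<^sub>v TC \<ominus>\<^sub>v vint 2) c x
               + exp_form (scl (1 / 24) P) * A)))"
    (is "\<forall>c\<in>AX. \<forall>x\<in>chart_dom c. ?goal c x")
proof (intro ballI)
  fix c x assume cAX: "c \<in> AX" and xc: "x \<in> chart_dom c"
  have "smooth_atlas AX" using fibration by (simp add: fibre_bundle_def)
  then have cx: "chart_at c x"
    using cAX xc by (auto simp: smooth_atlas_def chart_at_def)
  have "euclidean_bundle AX 10 TZ" "euclidean_bundle AX 2 \<xi>"
    using TZ \<xi> by (simp_all add: vertical_tangent_bundle_def oriented_plane_bundle_def)
  note eT = euclidean_bundle_regular[OF this(1) cAX xc] and e\<xi> = euclidean_bundle_regular[OF this(2) cAX xc]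
    and eF = euclidean_bundle_regular[OF F cAX xc]
  define t where "t = power_sum (complexify TZ) c x"
  define p where "p = power_sum (complexify F) c x"
  define A where "A = genus_series Ahat_fps TZ c x"
  define e where "e = euler_class \<xi> c x"
  define E where "E = efps (fps_exp 1) (escl (1 / 2) e)"
  define P where "P = escl (1 / 2) (t 2) - escl (1 / 2) (p 2)"
  define R where "R = efps (fps_exp 1) (escl (1 / 24) P)"
  define Q where "Q = efps exp_quotient_fps P"
  define T where "T = trace_series (fps_exp 1) (complexify TZ) c x"
  define F' where "F' = trace_series (fps_exp 1) (complexify F) c x"
  define L where "L = trace_series (fps_exp 1) (ext2 (complexify F)) c x"
  define S where "S = chern_character (vreduced (complexify \<xi>)) c x"
  \<comment> \<open>10080 = 2 * 7!, and its powers clear the denominators up to degree 12; for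
    instance 362880 and 46080 divide its cube. Integer coefficients become numerals, which suits a
    ring without division.\<close>
  define D :: complex where "D = 10080"
  define x2 x4 x6 where "x2 = escl (1 / D) (t 2)" and "x4 = escl (1 / D ^ 2) (t 4)"
    and "x6 = escl (1 / D ^ 3) (t 6)"
  define p2 p4 p6 where "p2 = escl (1 / D) (p 2)" and "p4 = escl (1 / D ^ 2) (p 4)"
    and "p6 = escl (1 / D ^ 3) (p 6)"
  define y where "y = escl (1 / D) (e * e)"
  note scaled = x2_def x4_def x6_def p2_def p4_def p6_def y_def D_def
  note rC = eT(1)[THEN complexify_regular] eF(1)[THEN complexify_regular] e\<xi>(1)[THEN complexify_regular]
  note sC = eT(2)[THEN complexify_skew] eF(2)[THEN complexify_skew] e\<xi>(2)[THEN complexify_skew]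
  note odd = power_sum_odd[OF cx rC(1) sC(1)] power_sum_odd[OF cx rC(2) sC(2)] power_sum_odd[OF cx rC(3) sC(3)]
  have tp: "part k (t m) = (if k = m then t m else 0)" "part k (p m) = (if k = m then p m else 0)" for k m
    unfolding t_def p_def by (rule part_power_sum[OF cx rC(1)] part_power_sum[OF cx rC(2)])+
  have A: "part 0 A = 1" "part (Suc 0) A = 0" "part 2 A = - (210 * x2)" "part 3 A = 0"
    "part 4 A = 17640 * x4 + 22050 * (x2 * x2)" "part 5 A = 0"
    "part 6 A = - (2822400 * x6) - 3704400 * (x2 * x4) - 1543500 * (x2 * x2 * x2)"
    unfolding A_def part_genus_series[OF cx eT(1,2)] log_Ahat_fps_nth
    by (simp_all add: scaled t_def power_divide escl_simps flip: escl_numeral)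
  have P: "part k P = 0" if "k \<noteq> 2" for k
    using that by (simp add: P_def part_simps tp escl_simps)
  have P2: "part 2 P = 5040 * (x2 - p2)"
    by (simp add: P_def part_simps tp escl_simps scaled flip: escl_numeral)
  \<comment> \<open>Named so that the simplifier treats the difference as an atom and does not
    distribute scalars and products over it.\<close>
  define z where "z = x2 - p2"
  have Pz: "part 2 P = 5040 * z" using P2 by (simp add: z_def)
  have "part 0 R = 1" "part (Suc 0) R = 0" "part 2 R = 210 * z" "part 3 R = 0"
    "part 4 R = 22050 * (z * z)" "part 5 R = 0" "part 6 R = 1543500 * (z * z * z)"
    unfolding R_def
    by (simp_all add: part_exp part_simps P Pz escl_simps flip: escl_numeral)
  note R = this[unfolded z_def]
  have epow: "e ^ 2 = e * e" "e ^ 4 = e * e * (e * e)" "e ^ 6 = e * e * (e * e) * (e * e)"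
    by (simp_all add: eval_nat_numeral mult.assoc)
  have Ek: "part k E = escl ((1 / 2) ^ k / fact k) (e ^ k)" for k
    unfolding E_def e_def by (rule part_exp_2_form) (rule euler_class(2)[OF cx e\<xi>(1,3)])
  have E: "part 0 E = 1" "part 2 E = 1260 * y" "part 4 E = 264600 * (y * y)"
    "part 6 E = 22226400 * (y * y * y)"
    by (simp_all add: Ek fact_numeral power_divide epow escl_simps scaled flip: escl_numeral)
  have T: "part 0 T = 10" "part (Suc 0) T = 0" "part 2 T = 5040 * x2" "part 3 T = 0"
    "part 4 T = 4233600 * x4" "part 5 T = 0" "part 6 T = 1422489600 * x6"
    unfolding T_def part_trace_series[OF cx rC(1)]
    by (simp_all add: power_sum_0 eT(3) odd fact_numeral escl_simps scaled t_def flip: escl_numeral)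
  have F': "part 0 F' = 32" "part (Suc 0) F' = 0" "part 2 F' = 5040 * p2" "part 3 F' = 0"
    "part 4 F' = 4233600 * p4" "part 5 F' = 0" "part 6 F' = 1422489600 * p6"
    unfolding F'_def part_trace_series[OF cx rC(2)]
    by (simp_all add: power_sum_0 eF(3) odd fact_numeral escl_simps scaled p_def flip: escl_numeral)
  note ext2 = power_sum_ext2_low[OF cx rC(2) sC(2), unfolded idx_complexify eF(3) card_lessThan, folded p_def]
  \<comment> \<open>496 = 32 * 31 / 2.\<close>
  have "power_sum (ext2 (complexify F)) c x 0 = 496"
    by (rule eform_double_cancel) (simp add: ext2(2))
  then have L: "part 0 L = 496" "part (Suc 0) L = 0" "part 2 L = 151200 * p2" "part 3 L = 0"
    "part 4 L = 101606400 * p4 + 12700800 * (p2 * p2)" "part 5 L = 0"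
    "part 6 L = 21337344000 * (p2 * p4)"
    unfolding L_def part_trace_series[OF cx ext2_regular[OF rC(2)]]
    by (simp_all add: ext2(1,3-) fact_numeral escl_simps scaled flip: escl_numeral)
  \<comment> \<open>The roots c and -c give 2 cosh c. Subtracting the rank leaves S = c^2 + c^4/12 +
    c^6/360 up to degree 12, with no constant term.\<close>
  note plane = power_sum_plane[OF cx e\<xi>, folded e_def]
  have S: "part 0 S = 0" "part (Suc 0) S = 0" "part 2 S = 10080 * y" "part 3 S = 0"
    "part 4 S = 8467200 * (y * y)" "part 5 S = 0" "part 6 S = 2844979200 * (y * y * y)"
    unfolding S_def chern_character_reduced part_simps part_trace_series[OF cx rC(3)]
    using plane[of 1] plane[of 2] plane[of 3]
    by (simp_all add: part_numeral power_sum_0 e\<xi>(3) odd fact_numeral escl_simps scaled epow flip: escl_numeral)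
  have PQ: "P * Q = R - 1"
    unfolding Q_def R_def by (rule exp_quotient) (simp add: P)
  have main: "part 6 (A * E * (L + T - 2 + 5 * (S * S) + 3 * ((1 - F') * S))) =
      P * part 4 (- Q * A * E * (L + T - 2 + 5 * (S * S) + 3 * ((1 - F') * S)) + R * A * E)"
    by (rule anomaly_factorization[OF P PQ], assumption,
        rule cancellation_identity[OF A R E T F' L S]) (simp_all add: P P2)
  \<comment> \<open>The case c = 0 is obtained by inserting 1 for e^(c/2) and 0 for \<open>S\<close>
    and y; both lemmas speak of arbitrary ring elements with prescribed parts.\<close>
  have "part 6 (A * 1 * (L + T - 2 + 5 * (0 * 0) + 3 * ((1 - F') * 0))) =
      P * part 4 (- Q * A * 1 * (L + T - 2 + 5 * (0 * 0) + 3 * ((1 - F') * 0)) + R * A * 1)"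
    by (rule anomaly_factorization[OF P PQ], assumption,
        rule cancellation_identity[where y = 0, OF A R _ _ _ _ T F' L])
      (simp_all add: P P2 part_one part_simps)
  then have trivial: "part 6 (A * (L + T - 2)) = P * part 4 (- Q * A * (L + T - 2) + R * A)"
    by simp
  have reg: "regular_virtual c x (vb (complexify TZ))" "regular_virtual c x (vb (complexify F))"
    "regular_virtual c x (vb (ext2 (complexify F)))" "regular_virtual c x (vreduced (complexify \<xi>))"
    by (intro regular_virtual_intros rC ext2_regular)+
  note ch = to_form_chern_character[OF cx, symmetric]
  have eqs: "Ahat TZ c x = to_form A" "euler_form \<xi> c x = to_form e"
    "p1 TZ c x - p1 F c x = to_form P"
    using eT eF e\<xi>
    by (simp_all add: Ahat_def A_def to_form_genus_series cx e_def euler_class P_def p1_eq_power_sum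
        to_form_simps t_def p_def)
  have chs: "ch (vb (ext2 (complexify F))) c x = to_form L"
    "ch (vb (complexify TZ)) c x = to_form T"
    "ch (vreduced (complexify \<xi>) \<otimes>\<^sub>v vreduced (complexify \<xi>)) c x = to_form (S * S)"
    "ch ((vint 1 \<ominus>\<^sub>v vb (complexify F)) \<otimes>\<^sub>v vreduced (complexify \<xi>)) c x = to_form ((1 - F') * S)"
    "ch (vb (ext2 (complexify F)) \<oplus>\<^sub>v vb (complexify TZ) \<ominus>\<^sub>v vint 2
        \<oplus>\<^sub>v vscale 5 (vreduced (complexify \<xi>) \<otimes>\<^sub>v vreduced (complexify \<xi>))
        \<oplus>\<^sub>v vscale 3 ((vint 1 \<ominus>\<^sub>v vb (complexify F)) \<otimes>\<^sub>v vreduced (complexify \<xi>))) c x =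
      to_form (L + T - 2 + 5 * (S * S) + 3 * ((1 - F') * S))"
    "ch (vb (ext2 (complexify F)) \<oplus>\<^sub>v vb (complexify TZ) \<ominus>\<^sub>v vint 2) c x = to_form (L + T - 2)"
    by (simp_all add: ch reg regular_virtual_intros chern_character_simps chern_character_tensor[OF cx]
        L_def T_def S_def F'_def)
  have comp: "component 12 (to_form a) = to_form (part 6 a)" "component 8 (to_form a) = to_form (part 4 a)" for a
    by (simp_all add: part.rep_eq)
  \<comment> \<open>Read from right to left, these rules gather each side of the goal into
    \<open>to_form\<close> of a single even form, to which \<open>main\<close> and
    \<open>trivial\<close> apply.\<close>
  note fold = to_form_simps(3-7)[symmetric] to_form_numeral[symmetric] to_form_efps[symmetric] comp
  \<comment> \<open>\<open>U\<close> stands for \<open>A * E\<close> in the first formula and for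
    \<open>A\<close> in the second.\<close>
  have expand: "part 6 (U * (L + T - 2 + 5 * (S * S) + 3 * ((1 - F') * S))) =
      part 6 (U * L) + part 6 (U * T) - 2 * part 6 U + 5 * part 6 (U * (S * S)) + 3 * part 6 (U * ((1 - F') * S))"
    "part 6 (U * (L + T - 2)) = part 6 (U * L) + part 6 (U * T) - 2 * part 6 U" for U
  proof -
    have "U * (L + T - 2 + 5 * (S * S) + 3 * ((1 - F') * S)) =
        U * L + U * T - 2 * U + 5 * (U * (S * S)) + 3 * (U * ((1 - F') * S))"
      "U * (L + T - 2) = U * L + U * T - 2 * U" by (simp_all add: algebra_simps)
    then show "part 6 (U * (L + T - 2 + 5 * (S * S) + 3 * ((1 - F') * S))) =
        part 6 (U * L) + part 6 (U * T) - 2 * part 6 U + 5 * part 6 (U * (S * S)) + 3 * part 6 (U * ((1 - F') * S))"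
      "part 6 (U * (L + T - 2)) = part 6 (U * L) + part 6 (U * T) - 2 * part 6 U"
      by (simp_all only: part_simps part_numeral_mult)
  qed
  show "?goal c x"
    unfolding Let_def eqs chs exp_form_def fold Q_def[symmetric] R_def[symmetric] E_def[symmetric]
    using main trivial unfolding expand by simp
qed

end
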